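(* Let $m,n,k$ be nonnegative integers. (a) For $K\subseteq[k-1]$, $$\triangle\mathcal B(q,t)_{\mathrm{comp}(K)}=\sum_{\substack{m+n=k\\ I\subseteq[m-1],\,J\subseteq[n-1]}}C^K_{I,J}(q,t)\,\mathcal B(q,t)_{\mathrm{comp}(I)}\otimes\mathcal B(q,t)_{\mathrm{comp}(J)},$$ where $$C^K_{I,J}(q,t)=t^{-|I|-|J|}\sum_{\substack{A\subseteq[m+n],\ |A|=n:\\ (I\#_AJ)\cap c(A)=\emptyset\\ I\#_AJ\subseteq K\subseteq(I\#_AJ)\cup c(A)}}(q+t)^{|K\cap c_2(A)|}\,t^{|K\setminus c_2(A)|}.$$ (b) For compositions $\alpha$ of $m$ and $\beta$ of $n$, $\mathcal B(q,t)_\alpha\mathcal B(q,t)_\beta=\mathcal B(q,t)_{\alpha\odot\beta}$.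
   Context: $q,t$ are commuting variables and $\mathsf{NSym}_{\mathbb C(q,t)}$ is the Hopf algebra of noncommutative symmetric functions over the field $\mathbb C(q,t)$, with basis $H_\alpha$ (dual to the monomial quasisymmetric functions). $[a,b]=\{t\in\mathbb Z:a\le t\le b\}$ (empty if $a>b$), $[n]=[1,n]$. Compositions of $n$ correspond to subsets of $[n-1]$ via $\mathrm{comp}(\{s_1<\dots<s_i\})=(s_1,s_2-s_1,\dots,n-s_i)$ (empty composition for $n=0$). For $I\subseteq[n-1]$, $\mathcal B(q,t)_{\mathrm{comp}(I)}=\sum_{J\subseteq[n-1]:\,I\cup J=[n-1]}q^{|I\setminus J|}t^{|I\cap J|}H_{\mathrm{comp}(J)}$. Near-concatenation: $(\alpha_1,\dots,\alpha_l)\odot(\beta_1,\dots,\beta_k)=(\alpha_1,\dots,\alpha_l+\beta_1,\beta_2,\dots,\beta_k)$, with the empty composition as identity. For $A\subseteq[N]$ ($N=m+n$), $\mathrm{conn}(A)$ = maximal subsets of consecutive integers of $A$, $A^c=[N]\setminus A$, $c_1(A)=\{\max B:B\in\mathrm{conn}(A)\}\setminus\{N\}$, $c_2(A)=\{\max B:B\in\mathrm{conn}(A^c)\}\setminus\{N\}$, $c(A)=c_1(A)\cup c_2(A)$. For $|A|=n$, $A=\{b_1<\dots<b_n\}$, $[m+n]\setminus A=\{a_1<\dots<a_m\}$, and $I\#_AJ=\{a_i:i\in I\}\cup\{b_j:j\in J\}$. *)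

theory Defs
  imports Complex_Main "HOL-Computational_Algebra.Polynomial" "HOL-Computational_Algebra.Fraction_Field"
begin

type_synonym cqt = "complex poly poly fract"

definition qv :: cqt where "qv = Fract [:0, 1:] 1"
definition tv :: cqt where "tv = Fract [:[:0, 1:]:] 1"

definition comp :: "nat \<Rightarrow> nat set \<Rightarrow> nat list" where
  "comp n I = (if n = 0 then [] else
     (let s = sorted_list_of_set I in map2 (\<lambda>a b. b - a) (0 # s) (s @ [n])))"

definition is_comp :: "nat list \<Rightarrow> bool" where
  "is_comp \<alpha> \<longleftrightarrow> 0 \<notin> set \<alpha>"

definition set_of_comp :: "nat list \<Rightarrow> nat set" where
  "set_of_comp \<alpha> = {sum_list (take i \<alpha>) | i. 0 < i \<and> i < length \<alpha>}"

definition odot :: "nat list \<Rightarrow> nat list \<Rightarrow> nat list" where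
  "odot \<alpha> \<beta> = (if \<alpha> = [] then \<beta> else if \<beta> = [] then \<alpha>
                 else butlast \<alpha> @ [last \<alpha> + hd \<beta>] @ tl \<beta>)"

text \<open>An element of NSym is represented by its coefficient function
  (composition \<mapsto> coefficient of H_composition); an element of
  NSym \<otimes> NSym by its coefficient function on pairs of compositions.\<close>

(* coefficient of H_gamma in B(q,t)_{comp(I)}, I \<subseteq> [n-1] *)
definition Bcoef :: "cqt \<Rightarrow> cqt \<Rightarrow> nat \<Rightarrow> nat set \<Rightarrow> nat list \<Rightarrow> cqt" where
  "Bcoef q t n I \<gamma> = (\<Sum>J\<in>{J. J \<subseteq> {1..<n} \<and> I \<union> J = {1..<n}}.
       if comp n J = \<gamma> then q ^ card (I - J) * t ^ card (I \<inter> J) else 0)"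

definition Bcomp :: "cqt \<Rightarrow> cqt \<Rightarrow> nat list \<Rightarrow> nat list \<Rightarrow> cqt" where
  "Bcomp q t \<alpha> = Bcoef q t (sum_list \<alpha>) (set_of_comp \<alpha>)"

(* product: H_alpha H_beta = H_(alpha @ beta) *)
definition nsym_mult :: "(nat list \<Rightarrow> 'a::comm_ring_1) \<Rightarrow> (nat list \<Rightarrow> 'a) \<Rightarrow> nat list \<Rightarrow> 'a" where
  "nsym_mult f g \<gamma> = (\<Sum>i\<in>{0..length \<gamma>}. f (take i \<gamma>) * g (drop i \<gamma>))"

(* coefficient of H_beta \<otimes> H_gamma in Delta H_alpha, where
   Delta H_n = sum_{i+j=n} H_i \<otimes> H_j, H_0 = 1, Delta multiplicative *)
definition deltaH :: "nat list \<Rightarrow> nat list \<Rightarrow> nat list \<Rightarrow> nat" where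
  "deltaH \<alpha> \<beta> \<gamma> = card {a. length a = length \<alpha> \<and> list_all2 (\<le>) a \<alpha>
       \<and> filter (\<lambda>x. x \<noteq> 0) a = \<beta> \<and> filter (\<lambda>x. x \<noteq> 0) (map2 (-) \<alpha> a) = \<gamma>}"

definition nsym_coprod :: "(nat list \<Rightarrow> 'a::comm_ring_1) \<Rightarrow> nat list \<times> nat list \<Rightarrow> 'a" where
  "nsym_coprod f = (\<lambda>(\<beta>, \<gamma>). \<Sum>\<alpha>\<in>{\<alpha>. is_comp \<alpha> \<and> sum_list \<alpha> = sum_list \<beta> + sum_list \<gamma>}.
       f \<alpha> * of_nat (deltaH \<alpha> \<beta> \<gamma>))"

definition is_interval :: "nat set \<Rightarrow> bool" where
  "is_interval B \<longleftrightarrow> (\<exists>a b. B = {a..b})"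

definition conn :: "nat set \<Rightarrow> nat set set" where
  "conn A = {B. B \<noteq> {} \<and> B \<subseteq> A \<and> is_interval B \<and>
      (\<forall>B'. B \<subseteq> B' \<and> B' \<subseteq> A \<and> is_interval B' \<longrightarrow> B' = B)}"

definition c1 :: "nat \<Rightarrow> nat set \<Rightarrow> nat set" where
  "c1 N A = (Max ` conn A) - {N}"

definition c2 :: "nat \<Rightarrow> nat set \<Rightarrow> nat set" where
  "c2 N A = (Max ` conn ({1..N} - A)) - {N}"

definition cc :: "nat \<Rightarrow> nat set \<Rightarrow> nat set" where
  "cc N A = c1 N A \<union> c2 N A"

definition nth_elem :: "nat set \<Rightarrow> nat \<Rightarrow> nat" where
  "nth_elem S i = sorted_list_of_set S ! (i - 1)"

definition sharp :: "nat \<Rightarrow> nat set \<Rightarrow> nat set \<Rightarrow> nat set \<Rightarrow> nat set" where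
  "sharp N A I J = nth_elem ({1..N} - A) ` I \<union> nth_elem A ` J"

definition Ccoef :: "cqt \<Rightarrow> cqt \<Rightarrow> nat \<Rightarrow> nat \<Rightarrow> nat set \<Rightarrow> nat set \<Rightarrow> nat set \<Rightarrow> cqt" where
  "Ccoef q t m n K I J = inverse (t ^ (card I + card J)) *
     (\<Sum>A\<in>{A. A \<subseteq> {1..m+n} \<and> card A = n \<and>
             sharp (m+n) A I J \<inter> cc (m+n) A = {} \<and>
             sharp (m+n) A I J \<subseteq> K \<and> K \<subseteq> sharp (m+n) A I J \<union> cc (m+n) A}.
        (q + t) ^ card (K \<inter> c2 (m+n) A) * t ^ card (K - c2 (m+n) A))"

end

theory Submission
  imports Defs
begin

text \<open>Writing \<open>U\<close> for the set of uncut positions, \<open>B_K\<close> is the sum over \<open>U \<subseteq> K\<close> of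
  \<open>q^|U| t^|K - U|\<close> times the \<open>H\<close> whose cuts are the complement of \<open>U\<close>. The terms of the coproduct of \<open>H_J\<close>
  are indexed by the \<open>A \<subseteq> [k]\<close> with \<open>c1 A \<subseteq> J\<close>, the two tensor factors being the restrictions of
  \<open>J\<close> to the complement of \<open>A\<close> and to \<open>A\<close>. For fixed \<open>A\<close> the sum over \<open>U\<close> factors over positions:
  those of \<open>K\<close> in \<open>c1\<close> must be cut and give \<open>t\<close>, those in \<open>c2\<close> are cut in both restrictions anyway and
  give \<open>q + t\<close>, and the remaining ones, \<open>K - c A\<close>, split into two independent sums, which are
  \<open>B_I\<close> and \<open>B_J\<close> for the unique \<open>I\<close>, \<open>J\<close> with \<open>I #_A J = K - c A\<close>.
  For the product, the position between the two factors is always cut.\<close>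

section \<open>Compositions and partial sums\<close>

definition psum :: "nat list \<Rightarrow> nat \<Rightarrow> nat" where
  "psum \<alpha> i = sum_list (take i \<alpha>)"

lemma psum_0 [simp]: "psum \<alpha> 0 = 0"
  by (simp add: psum_def)

lemma psum_length [simp]: "psum \<alpha> (length \<alpha>) = sum_list \<alpha>"
  by (simp add: psum_def)

lemma psum_Suc: "i < length \<alpha> \<Longrightarrow> psum \<alpha> (Suc i) = psum \<alpha> i + \<alpha> ! i"
  by (simp add: psum_def take_Suc_conv_app_nth)

lemma psum_mono: "i \<le> j \<Longrightarrow> psum \<alpha> i \<le> psum \<alpha> j"
proof -
  assume "i \<le> j"
  then have "take j \<alpha> = take i \<alpha> @ take (j - i) (drop i \<alpha>)"
    by (metis le_add_diff_inverse take_add)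
  then show ?thesis by (simp add: psum_def)
qed

lemma psum_strict_mono:
  assumes "is_comp \<alpha>" "i < j" "j \<le> length \<alpha>"
  shows "psum \<alpha> i < psum \<alpha> j"
proof -
  have "\<alpha> ! i \<noteq> 0"
    using assms by (metis is_comp_def nth_mem order_less_le_trans)
  then have "psum \<alpha> i < psum \<alpha> (Suc i)"
    using assms by (simp add: psum_Suc)
  also have "\<dots> \<le> psum \<alpha> j"
    using assms by (intro psum_mono) simp
  finally show ?thesis .
qed

lemma set_of_comp_eq: "set_of_comp \<alpha> = psum \<alpha> ` {0<..<length \<alpha>}"
  by (auto simp: set_of_comp_def psum_def)

lemma set_of_comp_subset:
  assumes "is_comp \<alpha>"
  shows "set_of_comp \<alpha> \<subseteq> {1..<sum_list \<alpha>}"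
proof
  fix x assume "x \<in> set_of_comp \<alpha>"
  then obtain i where "x = psum \<alpha> i" "0 < i" "i < length \<alpha>"
    by (auto simp: set_of_comp_eq)
  then show "x \<in> {1..<sum_list \<alpha>}"
    using psum_strict_mono[OF assms, of 0 i] psum_strict_mono[OF assms, of i "length \<alpha>"]
    by auto
qed

lemma sorted_list_of_set_of_comp:
  assumes "is_comp \<alpha>"
  shows "sorted_list_of_set (set_of_comp \<alpha>) = map (psum \<alpha>) [1..<length \<alpha>]"
proof -
  have "sorted_wrt (<) (map (psum \<alpha>) [1..<length \<alpha>])"
    unfolding sorted_wrt_iff_nth_less by (auto intro!: psum_strict_mono assms)
  moreover have "set (map (psum \<alpha>) [1..<length \<alpha>]) = set_of_comp \<alpha>"
    by (auto simp: set_of_comp_eq)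
  ultimately show ?thesis
    by (metis sorted_list_of_set.idem_if_sorted_distinct strict_sorted_iff)
qed

text \<open>The list from which \<open>comp\<close> takes differences, zero and the total included,
  consists of all partial sums of \<open>\<alpha>\<close> in increasing order, so consecutive
  differences are the parts of \<open>\<alpha>\<close>.\<close>

lemma comp_set_of_comp:
  assumes "is_comp \<alpha>"
  shows "comp (sum_list \<alpha>) (set_of_comp \<alpha>) = \<alpha>"
proof (cases "\<alpha> = []")
  case True
  then show ?thesis by (simp add: comp_def)
next
  case False
  let ?s = "map (psum \<alpha>) [1..<length \<alpha>]"
  have "psum \<alpha> 0 < psum \<alpha> (length \<alpha>)"
    using False by (intro psum_strict_mono assms) auto
  then have "comp (sum_list \<alpha>) (set_of_comp \<alpha>) = map2 (\<lambda>a b. b - a) (0 # ?s) (?s @ [sum_list \<alpha>])"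
    by (simp add: comp_def Let_def sorted_list_of_set_of_comp[OF assms] del: sum_list_eq_0_iff upt_Suc)
  also have "\<dots> = \<alpha>"
  proof (rule nth_equalityI)
    show "length (map2 (\<lambda>a b. b - a) (0 # ?s) (?s @ [sum_list \<alpha>])) = length \<alpha>"
      using False by (simp add: Suc_le_eq)
    fix i assume "i < length (map2 (\<lambda>a b. b - a) (0 # ?s) (?s @ [sum_list \<alpha>]))"
    moreover have "0 < length \<alpha>" using False by simp
    ultimately have i: "i < length \<alpha>" by simp
    have "(0 # ?s) ! i = psum \<alpha> i"
      using i by (cases i) auto
    moreover have "(?s @ [sum_list \<alpha>]) ! i = psum \<alpha> (Suc i)"
    proof (cases "Suc i = length \<alpha>")
      case True
      then have "i = length ?s" by simp
      then have "(?s @ [sum_list \<alpha>]) ! i = sum_list \<alpha>" by (metis nth_append_length)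
      then show ?thesis using True psum_length by metis
    next
      case False
      then have "Suc i < length \<alpha>" using i by simp
      then have "i < length ?s" by simp
      then show ?thesis by (simp add: nth_append)
    qed
    ultimately show "map2 (\<lambda>a b. b - a) (0 # ?s) (?s @ [sum_list \<alpha>]) ! i = \<alpha> ! i"
      using i psum_Suc[OF i] by simp
  qed
  finally show ?thesis .
qed

text \<open>All three facts come from the list \<open>e\<close> made of 0, the sorted cuts and
  \<open>n\<close>. It is strictly increasing, so its differences are positive and telescope: the
  partial sums of \<open>comp n I\<close> are exactly the entries of \<open>e\<close>.\<close>

lemma comp_properties:
  assumes "I \<subseteq> {1..<n}"
  shows is_comp_comp: "is_comp (comp n I)"
    and sum_list_comp: "sum_list (comp n I) = n"
    and set_of_comp_comp: "set_of_comp (comp n I) = I"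
proof -
  have "is_comp (comp n I) \<and> sum_list (comp n I) = n \<and> set_of_comp (comp n I) = I"
  proof (cases "n = 0")
    case True
    then show ?thesis using assms by (auto simp: comp_def is_comp_def set_of_comp_def)
  next
    case False
    define s where "s = sorted_list_of_set I"
    define e where "e = (0 # s) @ [n]"
    have fin: "finite I" using assms finite_subset by blast
    have ss: "set s = I" and st: "sorted_wrt (<) s"
      unfolding s_def using fin by auto
    have len_e: "length e = Suc (Suc (length s))" by (simp add: e_def)
    have "sorted_wrt (<) e"
      unfolding e_def using st ss assms False by (auto simp: sorted_wrt_append)
    then have e_less: "e ! i < e ! j" if "i < j" "j < length e" for i j
      using that by (simp add: sorted_wrt_iff_nth_less)
    let ?c = "comp n I"
    have c: "?c = map2 (\<lambda>a b. b - a) (0 # s) (s @ [n])"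
      using False by (simp add: comp_def Let_def s_def)
    have len: "length ?c = Suc (length s)" by (simp add: c)
    have nth: "?c ! i = e ! Suc i - e ! i" if "i < length ?c" for i
      using that by (auto simp: c e_def nth_append nth_Cons split: nat.splits)
    have ps: "psum ?c i = e ! i" if "i \<le> length ?c" for i
      using that
    proof (induction i)
      case 0
      then show ?case by (simp add: e_def)
    next
      case (Suc i)
      then show ?case
        using e_less[of i "Suc i"] len_e len by (simp add: psum_Suc nth)
    qed
    have "is_comp ?c"
      unfolding is_comp_def in_set_conv_nth
      using e_less len len_e by (force simp: nth)
    moreover have "sum_list ?c = n"
      using ps[of "length ?c"] unfolding psum_length by (simp add: len e_def)
    moreover have "set_of_comp ?c = I"
    proof -
      have "set_of_comp ?c = (\<lambda>i. e ! i) ` {0<..<length ?c}"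
        unfolding set_of_comp_eq by (intro image_cong) (auto simp: ps)
      also have "{0<..<length ?c} = Suc ` {..<length s}"
        by (auto simp: len image_iff gr0_conv_Suc)
      also have "(\<lambda>i. e ! i) ` (Suc ` {..<length s}) = (\<lambda>i. s ! i) ` {..<length s}"
        unfolding image_image by (intro image_cong) (auto simp: e_def nth_append)
      also have "\<dots> = I"
        using ss by (auto simp: set_conv_nth)
      finally show ?thesis .
    qed
    ultimately show ?thesis by blast
  qed
  then show "is_comp (comp n I)" "sum_list (comp n I) = n" "set_of_comp (comp n I) = I"
    by auto
qed

section \<open>Deleting zero parts\<close>

lemma sum_list_filter_nonzero: "sum_list (filter (\<lambda>x. x \<noteq> 0) l) = sum_list (l :: nat list)"
  by (induction l) auto

lemma take_filter_conv: "\<exists>j \<le> length l. take i (filter P l) = filter P (take j l)"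
proof (induction l arbitrary: i)
  case Nil
  then show ?case by simp
next
  case (Cons x l)
  show ?case
  proof (cases "i = 0")
    case True
    then show ?thesis by (intro exI[of _ 0]) auto
  next
    case False
    obtain j where "j \<le> length l" "take (if P x then i - 1 else i) (filter P l) = filter P (take j l)"
      using Cons.IH by blast
    then show ?thesis
      using False by (intro exI[of _ "Suc j"]) (auto simp: take_Cons' split: if_splits)
  qed
qed

text \<open>Deleting zeros only removes repetitions among the partial sums. Zero parts at either end
  can repeat the values 0 and \<open>sum_list l\<close> at interior indices of \<open>l\<close>, and
  these are never cuts.\<close>

lemma set_of_comp_filter_nonzero:
  "set_of_comp (filter (\<lambda>x. x \<noteq> 0) l) = psum l ` {..length l} - {0, sum_list l}"
proof -
  let ?P = "\<lambda>x :: nat. x \<noteq> 0"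
  let ?f = "filter ?P l"
  have comp_f: "is_comp ?f" by (simp add: is_comp_def)
  show ?thesis
  proof (intro equalityI subsetI)
    fix x assume x: "x \<in> set_of_comp ?f"
    then obtain i where "x = psum ?f i" by (auto simp: set_of_comp_eq)
    moreover obtain j where "j \<le> length l" "take i ?f = filter ?P (take j l)"
      using take_filter_conv by blast
    ultimately have "x = psum l j" "j \<le> length l"
      using sum_list_filter_nonzero[of "take j l"] by (auto simp: psum_def)
    moreover have "x \<noteq> 0" "x \<noteq> sum_list l"
      using set_of_comp_subset[OF comp_f] x unfolding sum_list_filter_nonzero by auto
    ultimately show "x \<in> psum l ` {..length l} - {0, sum_list l}" by auto
  next
    fix x assume "x \<in> psum l ` {..length l} - {0, sum_list l}"
    then obtain j where j: "x = psum l j" "x \<noteq> 0" "x \<noteq> sum_list l" by auto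
    \<comment> \<open>The index in the filtered list that corresponds to index \<open>j\<close> in
      \<open>l\<close>: the number of nonzero entries before it.\<close>
    define i where "i = length (filter ?P (take j l))"
    have app: "?f = filter ?P (take j l) @ filter ?P (drop j l)"
      by (metis append_take_drop_id filter_append)
    then have "take i ?f = filter ?P (take j l)" by (simp add: i_def)
    then have "psum ?f i = x"
      using j sum_list_filter_nonzero[of "take j l"] by (simp add: psum_def)
    moreover have "0 < i"
      using j(2) \<open>psum ?f i = x\<close> by (cases i) auto
    moreover have "i < length ?f"
    proof (rule ccontr)
      assume "\<not> i < length ?f"
      then have "psum ?f i = sum_list ?f" by (simp add: psum_def)
      then show False using j \<open>psum ?f i = x\<close> by (simp add: sum_list_filter_nonzero del: neq0_conv)
    qed
    ultimately show "x \<in> set_of_comp ?f" by (auto simp: set_of_comp_eq)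
  qed
qed

section \<open>Restricting a composition to a subset of its cells\<close>

definition rank :: "nat set \<Rightarrow> nat \<Rightarrow> nat" where
  "rank S j = card (S \<inter> {1..j})"

text \<open>The cells 1 to \<open>sum_list \<alpha>\<close> fall into consecutive blocks, one per
  part of \<open>\<alpha>\<close>. Counting the cells of \<open>S\<close> in each block gives a weak
  composition, with a zero for every block that misses \<open>S\<close>.\<close>

definition block_cards :: "nat list \<Rightarrow> nat set \<Rightarrow> nat list" where
  "block_cards \<alpha> S = map (\<lambda>i. card (S \<inter> {psum \<alpha> i<..psum \<alpha> (Suc i)})) [0..<length \<alpha>]"

lemma length_block_cards [simp]: "length (block_cards \<alpha> S) = length \<alpha>"
  by (simp add: block_cards_def)

lemma psum_block_cards:
  assumes "i \<le> length \<alpha>"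
  shows "psum (block_cards \<alpha> S) i = rank S (psum \<alpha> i)"
  using assms
proof (induction i)
  case 0
  then show ?case by (simp add: rank_def)
next
  case (Suc i)
  have "S \<inter> {1..psum \<alpha> (Suc i)} = S \<inter> {1..psum \<alpha> i} \<union> S \<inter> {psum \<alpha> i<..psum \<alpha> (Suc i)}"
    using psum_mono[of i "Suc i" \<alpha>] by auto
  then have "rank S (psum \<alpha> (Suc i)) = rank S (psum \<alpha> i) + card (S \<inter> {psum \<alpha> i<..psum \<alpha> (Suc i)})"
    unfolding rank_def by (simp, subst card_Un_disjoint) auto
  moreover have "psum (block_cards \<alpha> S) (Suc i) =
      psum (block_cards \<alpha> S) i + card (S \<inter> {psum \<alpha> i<..psum \<alpha> (Suc i)})"
    using Suc.prems by (subst psum_Suc) (auto simp: block_cards_def)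
  ultimately show ?case using Suc by simp
qed

text \<open>Partial sums of the block counts are the ranks of the partial sums of
  \<open>\<alpha>\<close>. A cut of \<open>\<alpha>\<close> therefore becomes a cut at its rank,
  unless no cell of \<open>S\<close> lies before it or none lies after it.\<close>

lemma filter_block_cards:
  assumes "S \<subseteq> {1..sum_list \<alpha>}"
  shows "filter (\<lambda>x. x \<noteq> 0) (block_cards \<alpha> S) =
         comp (card S) (rank S ` set_of_comp \<alpha> - {0, card S})"
proof -
  let ?b = "block_cards \<alpha> S"
  let ?f = "filter (\<lambda>x. x \<noteq> 0) ?b"
  have rS: "rank S (sum_list \<alpha>) = card S"
    using assms by (simp add: rank_def Int_absorb2)
  then have sum_b: "sum_list ?b = card S"
    using psum_block_cards[of "length \<alpha>" \<alpha> S] psum_length[of ?b] by simp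
  have "set_of_comp ?f = psum ?b ` {..length \<alpha>} - {0, card S}"
    by (simp add: set_of_comp_filter_nonzero sum_b del: neq0_conv)
  also have "psum ?b ` {..length \<alpha>} = rank S ` psum \<alpha> ` {..length \<alpha>}"
    unfolding image_image by (intro image_cong) (auto simp: psum_block_cards)
  \<comment> \<open>The two extreme indices contribute the ranks 0 and \<open>card S\<close>, which
    are removed anyway; the interior ones give the cuts of \<open>\<alpha>\<close>.\<close>
  also have "{..length \<alpha>} = insert 0 (insert (length \<alpha>) {0<..<length \<alpha>})"
    by auto
  also have "rank S ` psum \<alpha> ` \<dots> - {0, card S} = rank S ` set_of_comp \<alpha> - {0, card S}"
    using rS by (auto simp: set_of_comp_eq rank_def)
  finally have "set_of_comp ?f = \<dots>" .
  moreover have "is_comp ?f" by (simp add: is_comp_def)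
  ultimately show ?thesis
    using comp_set_of_comp[of ?f] by (simp add: sum_list_filter_nonzero sum_b del: neq0_conv)
qed

text \<open>These are the sets with \<open>c1\<close> contained in the cuts of
  \<open>\<alpha>\<close>, phrased without \<open>conn\<close> so that membership can be propagated
  cell by cell through a block.\<close>

definition c1_closed :: "nat list \<Rightarrow> nat set set" where
  "c1_closed \<alpha> = {A. A \<subseteq> {1..sum_list \<alpha>} \<and>
     (\<forall>i\<in>A. Suc i \<le> sum_list \<alpha> \<longrightarrow> Suc i \<notin> A \<longrightarrow> i \<in> set_of_comp \<alpha>)}"

lemma block_exists:
  assumes "1 \<le> y" "y \<le> sum_list \<alpha>"
  shows "\<exists>i<length \<alpha>. psum \<alpha> i < y \<and> y \<le> psum \<alpha> (Suc i)"
proof -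
  define j where "j = (LEAST j. y \<le> psum \<alpha> j)"
  have ex: "y \<le> psum \<alpha> (length \<alpha>)" using assms by simp
  then have j: "y \<le> psum \<alpha> j" "j \<le> length \<alpha>"
    unfolding j_def by (rule LeastI, rule Least_le)
  then have "j \<noteq> 0" using assms by (intro notI) simp
  then obtain i where i: "j = Suc i" by (cases j) auto
  then have "\<not> y \<le> psum \<alpha> i"
    using not_less_Least[of i "\<lambda>j. y \<le> psum \<alpha> j"] by (auto simp: j_def)
  then show ?thesis using i j by (intro exI[of _ i]) auto
qed

lemma block_unique:
  assumes "psum \<alpha> i < y" "y \<le> psum \<alpha> (Suc i)" "psum \<alpha> j < y" "y \<le> psum \<alpha> (Suc j)"
  shows "i = j"
  using assms psum_mono[of "Suc i" j \<alpha>] psum_mono[of "Suc j" i \<alpha>]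
  by (cases i j rule: linorder_cases) auto

text \<open>No cut lies strictly inside a block, so \<open>A\<close> cannot be left there: once a
  cell of the block is in \<open>A\<close>, all later ones are. Hence \<open>A\<close> meets the
  block in a final segment, and the number of missing cells determines it.\<close>

lemma c1_closed_block:
  assumes A: "A \<in> c1_closed \<alpha>" and i: "i < length \<alpha>"
  defines "R \<equiv> {psum \<alpha> i<..psum \<alpha> (Suc i)}"
  shows "A \<inter> R = {psum \<alpha> i + card (R - A)<..psum \<alpha> (Suc i)}"
proof -
  have le: "psum \<alpha> (Suc i) \<le> sum_list \<alpha>"
    using psum_mono[of "Suc i" "length \<alpha>" \<alpha>] i by simp
  have up: "z \<in> A" if "y \<in> A" "psum \<alpha> i < y" "y \<le> z" "z \<le> psum \<alpha> (Suc i)" for y z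
    using that(3,4)
  proof (induction rule: dec_induct)
    case base
    then show ?case using that by simp
  next
    case (step z)
    show ?case
    proof (rule ccontr)
      assume "Suc z \<notin> A"
      then have "z \<in> set_of_comp \<alpha>"
        using A step le by (auto simp: c1_closed_def)
      then obtain j where "z = psum \<alpha> j" by (auto simp: set_of_comp_eq)
      then show False
        using psum_mono[of j i \<alpha>] psum_mono[of "Suc i" j \<alpha>] step that
        by (cases "j \<le> i") auto
    qed
  qed
  have fin: "finite R" by (simp add: R_def)
  define d where "d = card (R - A)"
  have mono: "psum \<alpha> i \<le> psum \<alpha> (Suc i)" by (intro psum_mono) simp
  show ?thesis
  proof (intro equalityI subsetI)
    fix y assume y: "y \<in> A \<inter> R"
    have "R - A \<subseteq> {psum \<alpha> i<..<y}"
    proof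
      fix z assume z: "z \<in> R - A"
      then have "\<not> y \<le> z" using up[of y z] y by (auto simp: R_def)
      then show "z \<in> {psum \<alpha> i<..<y}" using z by (auto simp: R_def)
    qed
    then have "card (R - A) \<le> card {psum \<alpha> i<..<y}" by (intro card_mono) auto
    also have "\<dots> = y - Suc (psum \<alpha> i)" by simp
    finally show "y \<in> {psum \<alpha> i + card (R - A)<..psum \<alpha> (Suc i)}"
      using y by (auto simp: R_def)
  next
    fix y assume y: "y \<in> {psum \<alpha> i + card (R - A)<..psum \<alpha> (Suc i)}"
    have "y \<in> A"
    proof (rule ccontr)
      assume "y \<notin> A"
      then have "{psum \<alpha> i<..y} \<subseteq> R - A"
        using up[of _ y] y by (auto simp: R_def)
      then have "card {psum \<alpha> i<..y} \<le> card (R - A)" using fin by (intro card_mono) auto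
      then show False using y by (simp add: le_diff_conv)
    qed
    then show "y \<in> A \<inter> R" using y by (auto simp: R_def)
  qed
qed

lemma block_subset:
  assumes "i < length \<alpha>"
  shows "{psum \<alpha> i<..psum \<alpha> (Suc i)} \<subseteq> {1..sum_list \<alpha>}"
  using psum_mono[of "Suc i" "length \<alpha>" \<alpha>] assms by auto

text \<open>The coproduct of \<open>H\<close> splits every part as \<open>a ! i\<close> plus a
  remainder. Such a splitting is encoded by the set \<open>A\<close> of cells going right;
  injectivity holds because \<open>A\<close> is a final segment of known size in each block.\<close>

lemma bij_betw_block_cards:
  "bij_betw (\<lambda>A. block_cards \<alpha> ({1..sum_list \<alpha>} - A)) (c1_closed \<alpha>) {a. list_all2 (\<le>) a \<alpha>}"
proof (rule bij_betw_imageI)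
  let ?B = "\<lambda>i. {psum \<alpha> i<..psum \<alpha> (Suc i)}"
  have nth: "block_cards \<alpha> ({1..sum_list \<alpha>} - A) ! i = card (?B i - A)"
    if "i < length \<alpha>" for A i
  proof -
    have "({1..sum_list \<alpha>} - A) \<inter> ?B i = ?B i - A"
      using block_subset[OF that] by blast
    then show ?thesis using that by (simp add: block_cards_def)
  qed
  show "inj_on (\<lambda>A. block_cards \<alpha> ({1..sum_list \<alpha>} - A)) (c1_closed \<alpha>)"
  proof (rule inj_onI)
    fix A A' assume A: "A \<in> c1_closed \<alpha>" and A': "A' \<in> c1_closed \<alpha>"
      and eq: "block_cards \<alpha> ({1..sum_list \<alpha>} - A) = block_cards \<alpha> ({1..sum_list \<alpha>} - A')"
    have *: "A \<inter> ?B i = A' \<inter> ?B i" if "i < length \<alpha>" for i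
      using c1_closed_block[OF A that] c1_closed_block[OF A' that] nth[OF that, of A]
        nth[OF that, of A'] eq by simp
    have "A \<subseteq> {1..sum_list \<alpha>}" "A' \<subseteq> {1..sum_list \<alpha>}"
      using A A' by (auto simp: c1_closed_def)
    moreover have "\<exists>i<length \<alpha>. y \<in> ?B i" if "y \<in> {1..sum_list \<alpha>}" for y
      using block_exists[of y \<alpha>] that by auto
    ultimately show "A = A'"
      using * by blast
  qed
  show "(\<lambda>A. block_cards \<alpha> ({1..sum_list \<alpha>} - A)) ` c1_closed \<alpha> = {a. list_all2 (\<le>) a \<alpha>}"
  proof (intro equalityI subsetI)
    fix a assume "a \<in> (\<lambda>A. block_cards \<alpha> ({1..sum_list \<alpha>} - A)) ` c1_closed \<alpha>"
    then obtain A where a: "a = block_cards \<alpha> ({1..sum_list \<alpha>} - A)" by auto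
    have "a ! i \<le> \<alpha> ! i" if "i < length \<alpha>" for i
    proof -
      have "a ! i \<le> card (?B i)"
        unfolding a nth[OF that] by (intro card_mono) auto
      then show ?thesis using that by (simp add: psum_Suc)
    qed
    then show "a \<in> {a. list_all2 (\<le>) a \<alpha>}"
      by (simp add: list_all2_conv_all_nth a)
  next
    fix a assume "a \<in> {a. list_all2 (\<le>) a \<alpha>}"
    then have len: "length a = length \<alpha>" and le: "\<And>i. i < length \<alpha> \<Longrightarrow> a ! i \<le> \<alpha> ! i"
      by (auto simp: list_all2_conv_all_nth)
    \<comment> \<open>The preimage of \<open>a\<close>: the first \<open>a ! i\<close> cells of
      block \<open>i\<close> go left, and the others form \<open>A\<close>.\<close>
    define A where "A = (\<Union>i<length \<alpha>. {psum \<alpha> i + a ! i<..psum \<alpha> (Suc i)})"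
    have AB: "A \<inter> ?B i = {psum \<alpha> i + a ! i<..psum \<alpha> (Suc i)}" if i: "i < length \<alpha>" for i
    proof (intro equalityI subsetI)
      fix y assume y: "y \<in> A \<inter> ?B i"
      then obtain j where j: "j < length \<alpha>" "psum \<alpha> j + a ! j < y" "y \<le> psum \<alpha> (Suc j)"
        by (auto simp: A_def)
      then have "i = j" using y by (intro block_unique[of \<alpha> i y j]) auto
      then show "y \<in> {psum \<alpha> i + a ! i<..psum \<alpha> (Suc i)}" using j by auto
    next
      fix y assume y: "y \<in> {psum \<alpha> i + a ! i<..psum \<alpha> (Suc i)}"
      then have "y \<in> A" unfolding A_def using i by blast
      then show "y \<in> A \<inter> ?B i" using y by auto
    qed
    have sub: "A \<subseteq> {1..sum_list \<alpha>}"
      unfolding A_def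
    proof (rule UN_least)
      fix i assume "i \<in> {..<length \<alpha>}"
      then have "?B i \<subseteq> {1..sum_list \<alpha>}" by (intro block_subset) simp
      then show "{psum \<alpha> i + a ! i<..psum \<alpha> (Suc i)} \<subseteq> {1..sum_list \<alpha>}" by auto
    qed
    have "A \<in> c1_closed \<alpha>"
      unfolding c1_closed_def
    proof (intro CollectI conjI sub ballI impI)
      fix y assume y: "y \<in> A" "Suc y \<le> sum_list \<alpha>" "Suc y \<notin> A"
      then obtain i where i: "i < length \<alpha>" "psum \<alpha> i + a ! i < y" "y \<le> psum \<alpha> (Suc i)"
        by (auto simp: A_def)
      have "y = psum \<alpha> (Suc i)"
      proof (rule ccontr)
        assume "y \<noteq> psum \<alpha> (Suc i)"
        then have "Suc y \<in> A \<inter> ?B i" unfolding AB[OF i(1)] using i by auto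
        then show False using y(3) by simp
      qed
      \<comment> \<open>The end of the last block is the total, which
        \<open>Suc y \<le> sum_list \<alpha>\<close> rules out, so \<open>y\<close> is an interior
        partial sum.\<close>
      moreover from this have "Suc i \<noteq> length \<alpha>"
        using y(2) psum_length[of \<alpha>] by (intro notI) simp
      ultimately show "y \<in> set_of_comp \<alpha>" using i by (auto simp: set_of_comp_eq)
    qed
    moreover have "a = block_cards \<alpha> ({1..sum_list \<alpha>} - A)"
    proof (rule nth_equalityI)
      fix i assume "i < length a"
      then have i: "i < length \<alpha>" by (simp add: len)
      have "?B i - A = ?B i - {psum \<alpha> i + a ! i<..psum \<alpha> (Suc i)}" using AB[OF i] by blast
      also have "\<dots> = {psum \<alpha> i<..psum \<alpha> i + a ! i}"
        using le[OF i] psum_Suc[OF i] by auto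
      finally show "a ! i = block_cards \<alpha> ({1..sum_list \<alpha>} - A) ! i"
        unfolding nth[OF i] by simp
    qed (simp add: len)
    ultimately show "a \<in> (\<lambda>A. block_cards \<alpha> ({1..sum_list \<alpha>} - A)) ` c1_closed \<alpha>"
      by blast
  qed
qed

text \<open>Within a block the cells of \<open>A\<close> and of its complement add up to the part of
  \<open>\<alpha>\<close>, so the right tensor factor is the restriction to
  \<open>A\<close>.\<close>

lemma map2_diff_block_cards:
  assumes "A \<subseteq> {1..sum_list \<alpha>}"
  shows "map2 (-) \<alpha> (block_cards \<alpha> ({1..sum_list \<alpha>} - A)) = block_cards \<alpha> A"
proof (rule nth_equalityI)
  fix i assume "i < length (map2 (-) \<alpha> (block_cards \<alpha> ({1..sum_list \<alpha>} - A)))"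
  then have i: "i < length \<alpha>" by simp
  let ?B = "{psum \<alpha> i<..psum \<alpha> (Suc i)}"
  have "({1..sum_list \<alpha>} - A) \<inter> ?B = ?B - A \<inter> ?B"
    using block_subset[OF i] by blast
  then have "card (({1..sum_list \<alpha>} - A) \<inter> ?B) = card ?B - card (A \<inter> ?B)"
    by (simp add: card_Diff_subset)
  moreover have "card (A \<inter> ?B) \<le> card ?B" by (intro card_mono) auto
  ultimately show "map2 (-) \<alpha> (block_cards \<alpha> ({1..sum_list \<alpha>} - A)) ! i = block_cards \<alpha> A ! i"
    using i psum_Suc[OF i] by (simp add: block_cards_def)
qed simp

section \<open>Ends of maximal runs: the sets \<open>c1\<close> and \<open>c2\<close>\<close>

lemma Max_conn: "Max ` conn A = {i \<in> A. Suc i \<notin> A}"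
proof (intro equalityI subsetI)
  fix x assume "x \<in> Max ` conn A"
  then obtain B where B: "B \<in> conn A" "x = Max B" by auto
  then obtain a b where ab: "B = {a..b}" "a \<le> b" "B \<subseteq> A"
    by (auto simp: conn_def is_interval_def)
  then have "x = b" using B by (auto intro!: Max_eqI)
  have "Suc b \<notin> A"
  proof
    assume "Suc b \<in> A"
    then have "{a..Suc b} \<subseteq> A" using ab by (auto simp: atLeastAtMostSuc_conv)
    moreover have "B \<subseteq> {a..Suc b}" using ab by auto
    moreover have "is_interval {a..Suc b}" unfolding is_interval_def by blast
    ultimately have "{a..Suc b} = B"
      using B(1) unfolding conn_def by blast
    then show False using ab by auto
  qed
  then show "x \<in> {i \<in> A. Suc i \<notin> A}" using ab \<open>x = b\<close> by auto
next
  fix i assume i: "i \<in> {i \<in> A. Suc i \<notin> A}"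
  \<comment> \<open>The leftmost start of a run in \<open>A\<close> ending at \<open>i\<close>;
    minimality blocks an extension to the left, and \<open>Suc i \<notin> A\<close> blocks one to
    the right.\<close>
  define a where "a = (LEAST a. {a..i} \<subseteq> A)"
  have "{i..i} \<subseteq> A" using i by simp
  then have a: "{a..i} \<subseteq> A" "a \<le> i" unfolding a_def by (rule LeastI, rule Least_le)
  have "{a..i} \<in> conn A"
    unfolding conn_def
  proof (intro CollectI conjI allI impI)
    fix B' assume B': "{a..i} \<subseteq> B' \<and> B' \<subseteq> A \<and> is_interval B'"
    then obtain a' b' where ab: "B' = {a'..b'}" by (auto simp: is_interval_def)
    have le: "a' \<le> a" "i \<le> b'" using B' a by (auto simp: ab)
    have "b' \<le> i"
    proof (rule ccontr)
      assume "\<not> b' \<le> i"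
      then have "Suc i \<in> B'" using le a by (auto simp: ab)
      then show False using B' i by auto
    qed
    moreover have "{a'..i} \<subseteq> A" using B' le by (auto simp: ab)
    then have "a \<le> a'" unfolding a_def by (rule Least_le)
    ultimately show "B' = {a..i}" using le ab by auto
  qed (use a in \<open>auto simp: is_interval_def\<close>)
  moreover have "Max {a..i} = i" using a by (intro Max_eqI) auto
  ultimately show "i \<in> Max ` conn A" by (metis imageI)
qed

lemma c1_eq: "A \<subseteq> {1..N} \<Longrightarrow> c1 N A = {i \<in> {1..<N}. i \<in> A \<and> Suc i \<notin> A}"
  unfolding c1_def Max_conn by auto

lemma c2_eq: "c2 N A = {i \<in> {1..<N}. i \<notin> A \<and> Suc i \<in> A}"
  unfolding c2_def Max_conn by auto

lemma c1_closed_comp: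
  assumes "L \<subseteq> {1..<k}"
  shows "c1_closed (comp k L) = {A. A \<subseteq> {1..k} \<and> c1 k A \<subseteq> L}"
proof -
  have "(\<forall>i\<in>A. Suc i \<le> k \<longrightarrow> Suc i \<notin> A \<longrightarrow> i \<in> L) \<longleftrightarrow> c1 k A \<subseteq> L" if A: "A \<subseteq> {1..k}" for A
  proof -
    have "c1 k A = {i. i \<in> A \<and> Suc i \<le> k \<and> Suc i \<notin> A}"
      unfolding c1_eq[OF A] using A by force
    then show ?thesis by blast
  qed
  then show ?thesis
    unfolding c1_closed_def sum_list_comp[OF assms] set_of_comp_comp[OF assms] by blast
qed

text \<open>A subset \<open>A\<close> of the ground set records which cells go to the right tensor factor; inside each
  block the cells going left are put first, so that descents of the word \<open>A\<close> occur only at cuts.\<close>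

lemma deltaH_comp:
  assumes "L \<subseteq> {1..<k}"
  shows "deltaH (comp k L) \<beta> \<gamma> = card {A. A \<subseteq> {1..k} \<and> c1 k A \<subseteq> L \<and>
     comp (k - card A) (rank ({1..k} - A) ` L - {0, k - card A}) = \<beta> \<and>
     comp (card A) (rank A ` L - {0, card A}) = \<gamma>}"
proof -
  let ?\<alpha> = "comp k L"
  let ?f = "\<lambda>A. block_cards ?\<alpha> ({1..k} - A)"
  let ?nz = "filter (\<lambda>x::nat. x \<noteq> 0)"
  let ?T = "{A \<in> c1_closed ?\<alpha>. ?nz (?f A) = \<beta> \<and> ?nz (map2 (-) ?\<alpha> (?f A)) = \<gamma>}"
  have sum: "sum_list ?\<alpha> = k" and set: "set_of_comp ?\<alpha> = L"
    using assms by (simp_all add: sum_list_comp set_of_comp_comp)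
  have bij: "bij_betw ?f (c1_closed ?\<alpha>) {a. list_all2 (\<le>) a ?\<alpha>}"
    using bij_betw_block_cards[of ?\<alpha>] sum by simp
  then have im: "?f ` c1_closed ?\<alpha> = {a. list_all2 (\<le>) a ?\<alpha>}"
    by (simp add: bij_betw_def)
  have "{a. length a = length ?\<alpha> \<and> list_all2 (\<le>) a ?\<alpha> \<and> ?nz a = \<beta> \<and> ?nz (map2 (-) ?\<alpha> a) = \<gamma>}
      = {a \<in> ?f ` c1_closed ?\<alpha>. ?nz a = \<beta> \<and> ?nz (map2 (-) ?\<alpha> a) = \<gamma>}"
    unfolding im by (auto dest: list_all2_lengthD)
  also have "\<dots> = ?f ` ?T" by blast
  finally have "deltaH ?\<alpha> \<beta> \<gamma> = card (?f ` ?T)"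
    unfolding deltaH_def by (rule arg_cong)
  also have "\<dots> = card ?T"
  proof (rule card_image)
    show "inj_on ?f ?T"
      using bij by (auto simp: bij_betw_def intro: inj_on_subset)
  qed
  also have "?T = {A. A \<subseteq> {1..k} \<and> c1 k A \<subseteq> L \<and>
     comp (k - card A) (rank ({1..k} - A) ` L - {0, k - card A}) = \<beta> \<and>
     comp (card A) (rank A ` L - {0, card A}) = \<gamma>}"
  proof -
    have "?nz (?f A) = comp (k - card A) (rank ({1..k} - A) ` L - {0, k - card A})"
      "?nz (map2 (-) ?\<alpha> (?f A)) = comp (card A) (rank A ` L - {0, card A})"
      if "A \<subseteq> {1..k}" for A
    proof -
      have "card ({1..k} - A) = k - card A"
        using that by (simp add: card_Diff_subset finite_subset)
      then show "?nz (?f A) = comp (k - card A) (rank ({1..k} - A) ` L - {0, k - card A})"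
        using filter_block_cards[of "{1..k} - A" ?\<alpha>] by (simp add: sum set)
      show "?nz (map2 (-) ?\<alpha> (?f A)) = comp (card A) (rank A ` L - {0, card A})"
        using map2_diff_block_cards[of A ?\<alpha>] filter_block_cards[of A ?\<alpha>] that
        by (simp add: sum set)
    qed
    then show ?thesis
      unfolding c1_closed_comp[OF assms] by (intro Collect_cong) (simp cong: conj_cong)
  qed
  finally show ?thesis .
qed

section \<open>Ranks and restrictions\<close>

lemma rank_mono: "i \<le> j \<Longrightarrow> rank S i \<le> rank S j"
  unfolding rank_def by (intro card_mono) auto

lemma rank_less: "x \<in> S \<Longrightarrow> i < x \<Longrightarrow> rank S i < rank S x"
proof -
  assume "x \<in> S" "i < x"
  then have "x \<in> S \<inter> {1..x}" "x \<notin> S \<inter> {1..i}" "S \<inter> {1..i} \<subseteq> S \<inter> {1..x}" by auto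
  then have "S \<inter> {1..i} \<subset> S \<inter> {1..x}" by blast
  then show ?thesis unfolding rank_def by (intro psubset_card_mono) auto
qed

lemma rank_le_card: "finite S \<Longrightarrow> rank S i \<le> card S"
  unfolding rank_def by (intro card_mono) auto

lemma inj_on_rank: "inj_on (rank S) S"
proof (rule inj_onI)
  fix x y assume "x \<in> S" "y \<in> S" "rank S x = rank S y"
  then show "x = y"
    using rank_less[of x S y] rank_less[of y S x] by (cases x y rule: linorder_cases) auto
qed

lemma nth_elem_props:
  assumes "S \<subseteq> {1..N}" "p \<in> {1..card S}"
  shows nth_elem_in: "nth_elem S p \<in> S" and rank_nth_elem: "rank S (nth_elem S p) = p"
proof -
  define xs where "xs = sorted_list_of_set S"
  have fin: "finite S" using assms finite_subset by blast
  have xs: "set xs = S" "sorted_wrt (<) xs" "length xs = card S" "distinct xs"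
    using fin by (auto simp: xs_def)
  \<comment> \<open>\<open>nth_elem\<close> counts from one, list access from zero.\<close>
  obtain i where i: "p = Suc i" "i < card S" using assms(2) by (cases p) auto
  have e: "nth_elem S p = xs ! i" by (simp add: nth_elem_def i xs_def)
  show "nth_elem S p \<in> S" unfolding e using xs i by (metis nth_mem)
  have "S \<inter> {1..xs ! i} = set (take (Suc i) xs)"
  proof (intro equalityI subsetI)
    fix y assume y: "y \<in> S \<inter> {1..xs ! i}"
    then obtain j where j: "j < length xs" "y = xs ! j" by (metis IntD1 in_set_conv_nth xs(1))
    have "\<not> i < j"
      using y j xs(2) by (fastforce simp: sorted_wrt_iff_nth_less)
    then show "y \<in> set (take (Suc i) xs)"
      using j by (auto simp: in_set_conv_nth intro!: exI[of _ j])
  next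
    fix y assume "y \<in> set (take (Suc i) xs)"
    then obtain j where "j < Suc i" "y = xs ! j" by (auto simp: in_set_conv_nth)
    then have j: "j \<le> i" "y = xs ! j" by auto
    have "y \<in> S" using j i xs by auto
    moreover have "y \<le> xs ! i"
      using j i xs(2,3) by (cases "j = i") (auto simp: sorted_wrt_iff_nth_less intro: less_imp_le)
    ultimately show "y \<in> S \<inter> {1..xs ! i}" using assms(1) by auto
  qed
  then have "rank S (xs ! i) = card (set (take (Suc i) xs))" by (simp add: rank_def)
  also have "\<dots> = Suc i" using xs(3,4) i(2) distinct_card[of "take (Suc i) xs"] by simp
  finally show "rank S (nth_elem S p) = p" unfolding e by (simp add: i)
qed

lemma rank_in: "S \<subseteq> {1..N} \<Longrightarrow> x \<in> S \<Longrightarrow> rank S x \<in> {1..card S}"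
  using rank_less[of x S 0] rank_le_card[of S x] finite_subset[of S "{1..N}"] by (force simp: rank_def)

lemma nth_elem_rank:
  assumes "S \<subseteq> {1..N}" "x \<in> S"
  shows "nth_elem S (rank S x) = x"
proof -
  have r: "rank S x \<in> {1..card S}" using rank_in assms by blast
  show ?thesis
    using inj_on_rank nth_elem_in[OF assms(1) r] rank_nth_elem[OF assms(1) r] assms(2)
    by (metis inj_onD)
qed

text \<open>Each position in \<open>{1..<k}\<close> lies in exactly one of \<open>c1 k A\<close>,
  \<open>c2 k A\<close>, \<open>adj k A\<close> and \<open>adj k ({1..k} - A)\<close>, according to
  which of \<open>i\<close> and \<open>Suc i\<close> belong to \<open>A\<close>. The last two
  classes together form the complement of \<open>cc k A\<close>.\<close>

definition adj :: "nat \<Rightarrow> nat set \<Rightarrow> nat set" where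
  "adj k S = {i \<in> {1..<k}. i \<in> S \<and> Suc i \<in> S}"

lemma rank_cuts_subset:
  assumes "finite S"
  shows "rank S ` L - {0, card S} \<subseteq> {1..<card S}"
proof
  fix r assume r: "r \<in> rank S ` L - {0, card S}"
  then have "r \<le> card S" using rank_le_card[OF assms] by blast
  then show "r \<in> {1..<card S}" using r by auto
qed

lemma rank_adj_subset:
  assumes "S \<subseteq> {1..k}"
  shows "rank S ` adj k S \<subseteq> {1..<card S}"
proof
  fix r assume "r \<in> rank S ` adj k S"
  then obtain i where i: "i \<in> S" "Suc i \<in> S" "r = rank S i" by (auto simp: adj_def)
  then show "r \<in> {1..<card S}"
    using rank_in[OF assms, of i] rank_in[OF assms, of "Suc i"] rank_less[of "Suc i" S i] by auto
qed

text \<open>A position \<open>r\<close> of \<open>S\<close> stays uncut iff the whole gap between the \<open>r\<close>-th and the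
  \<open>(r + 1)\<close>-st element of \<open>S\<close> is uncut; the hypothesis excludes this for proper gaps.\<close>

lemma rank_uncut:
  assumes S: "S \<subseteq> {1..k}" and U: "U \<subseteq> {1..<k}"
    and gap: "\<And>i j. \<lbrakk>i \<in> S; j \<in> S; Suc i < j; {i<..<j} \<inter> S = {}\<rbrakk> \<Longrightarrow> \<not> {i..<j} \<subseteq> U"
  shows "rank S ` ({1..<k} - U) - {0, card S} = {1..<card S} - rank S ` (U \<inter> adj k S)"
proof -
  have fin: "finite S" using S finite_subset by blast
  have main: "r \<in> rank S ` ({1..<k} - U) \<longleftrightarrow> r \<notin> rank S ` (U \<inter> adj k S)" if r: "r \<in> {1..<card S}" for r
  proof -
    define i where "i = nth_elem S r"
    define j where "j = nth_elem S (Suc r)"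
    have i: "i \<in> S" "rank S i = r" and j: "j \<in> S" "rank S j = Suc r"
      using nth_elem_in[OF S, of r] rank_nth_elem[OF S, of r]
        nth_elem_in[OF S, of "Suc r"] rank_nth_elem[OF S, of "Suc r"] r
      by (auto simp: i_def j_def)
    have ij: "i < j" using rank_mono[of j i S] i j by (cases "i < j") auto
    have bnd: "1 \<le> i" "j \<le> k" using i j S by auto
    \<comment> \<open>The cuts that turn into a cut after the \<open>r\<close>-th element of
      \<open>S\<close> are those from that element \<open>i\<close> up to just before its successor
      \<open>j\<close> in \<open>S\<close>.\<close>
    have rank_iff: "rank S x = r \<longleftrightarrow> i \<le> x \<and> x < j" for x
    proof -
      have "rank S x < r" if "x < i" using rank_less[OF i(1) that] i by simp
      moreover have "Suc r \<le> rank S x" if "j \<le> x" using rank_mono[OF that, of S] j by simp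
      moreover have "r \<le> rank S x" if "i \<le> x" using rank_mono[OF that, of S] i by simp
      moreover have "rank S x < Suc r" if "x < j" using rank_less[OF j(1) that] j by simp
      ultimately show ?thesis by linarith
    qed
    have gap_S: "{i<..<j} \<inter> S = {}"
    proof (rule ccontr)
      assume "{i<..<j} \<inter> S \<noteq> {}"
      then obtain x where x: "i < x" "x < j" "x \<in> S" by auto
      then show False using rank_less[of x S i] rank_iff[of x] i by auto
    qed
    have "r \<in> rank S ` ({1..<k} - U) \<longleftrightarrow> (\<exists>x\<in>{1..<k} - U. rank S x = r)"
      by auto
    also have "\<dots> \<longleftrightarrow> (\<exists>x\<in>{1..<k} - U. i \<le> x \<and> x < j)"
      by (simp only: rank_iff)
    also have "\<dots> \<longleftrightarrow> \<not> {i..<j} \<subseteq> U"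
      using bnd by (auto simp: subset_iff)
    \<comment> \<open>By the gap hypothesis an interval from \<open>i\<close> to \<open>j\<close>
      without cuts must be a single position.\<close>
    also have "\<dots> \<longleftrightarrow> \<not> (j = Suc i \<and> i \<in> U)"
    proof -
      have "j = Suc i" if "{i..<j} \<subseteq> U"
        using gap[OF i(1) j(1) _ gap_S] that ij by (cases "Suc i < j") auto
      then show ?thesis using ij by (auto simp: subset_iff le_less_Suc_eq)
    qed
    also have "j = Suc i \<and> i \<in> U \<longleftrightarrow> r \<in> rank S ` (U \<inter> adj k S)"
    proof
      assume "j = Suc i \<and> i \<in> U"
      then show "r \<in> rank S ` (U \<inter> adj k S)"
        using i j bnd by (auto simp: adj_def)
    next
      assume "r \<in> rank S ` (U \<inter> adj k S)"
      then obtain u where u: "u \<in> U" "u \<in> S" "Suc u \<in> S" "rank S u = r" by (auto simp: adj_def)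
      have "u = i" using inj_onD[OF inj_on_rank[of S] _ u(2) i(1)] u(4) i(2) by simp
      moreover have "\<not> Suc i < j" using gap_S u \<open>u = i\<close> by auto
      ultimately show "j = Suc i \<and> i \<in> U" using u ij by auto
    qed
    finally show ?thesis by blast
  qed
  have "rank S ` ({1..<k} - U) - {0, card S} \<subseteq> {1..<card S}"
    by (rule rank_cuts_subset[OF fin])
  moreover have "0 \<notin> {1..<card S}" "card S \<notin> {1..<card S}" by auto
  ultimately show ?thesis using main by blast
qed

text \<open>A proper gap of \<open>A\<close> begins at an element of \<open>c1\<close>, which is
  cut. Positions of \<open>c2\<close> are therefore immaterial for this restriction.\<close>

lemma rank_uncut_right:
  assumes A: "A \<subseteq> {1..k}" and U: "U \<subseteq> {1..<k}" "U \<inter> c1 k A = {}"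
  shows "rank A ` ({1..<k} - U) - {0, card A} = {1..<card A} - rank A ` (U \<inter> adj k A)"
proof (rule rank_uncut[OF A U(1)])
  fix i j assume "i \<in> A" "j \<in> A" "Suc i < j" "{i<..<j} \<inter> A = {}"
  then have "i \<in> c1 k A" using A by (force simp: c1_eq)
  then show "\<not> {i..<j} \<subseteq> U" using U(2) \<open>Suc i < j\<close> by (auto simp: subset_iff)
qed

text \<open>Mirror image of the case of \<open>A\<close>: a proper gap of the complement from
  \<open>i\<close> to \<open>j\<close> is filled by elements of \<open>A\<close>, and the last of
  them, \<open>j - 1\<close>, lies in \<open>c1\<close> and is cut.\<close>

lemma rank_uncut_left:
  assumes A: "A \<subseteq> {1..k}" and U: "U \<subseteq> {1..<k}" "U \<inter> c1 k A = {}"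
  defines "A' \<equiv> {1..k} - A"
  shows "rank A' ` ({1..<k} - U) - {0, card A'} = {1..<card A'} - rank A' ` (U \<inter> adj k A')"
proof (rule rank_uncut[OF _ U(1)])
  fix i j assume ij: "i \<in> A'" "j \<in> A'" "Suc i < j" "{i<..<j} \<inter> A' = {}"
  then have "j - 1 \<in> {i<..<j}" by auto
  then have "j - 1 \<notin> A'" using ij by blast
  then have "j - 1 \<in> c1 k A" using A ij by (auto simp: c1_eq A'_def)
  then have "j - 1 \<notin> U" using U(2) by blast
  moreover have "j - 1 \<in> {i..<j}" using \<open>Suc i < j\<close> by auto
  ultimately show "\<not> {i..<j} \<subseteq> U" by blast
qed (auto simp: A'_def)

text \<open>Passing from the cuts \<open>J\<close> to the uncut positions \<open>U\<close> turns the
  condition \<open>I \<union> J = {1..<n}\<close> into \<open>U \<subseteq> I\<close>, so the sum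
  runs over a full power set and can be factored.\<close>

lemma Bcoef_Pow:
  assumes "I \<subseteq> {1..<n}"
  shows "Bcoef q t n I \<gamma> = (\<Sum>U\<in>Pow I. of_bool (comp n ({1..<n} - U) = \<gamma>) * (q ^ card U * t ^ card (I - U)))"
  unfolding Bcoef_def
proof (rule sum.reindex_bij_witness[where i = "\<lambda>U. {1..<n} - U" and j = "\<lambda>J. {1..<n} - J"])
  fix J assume "J \<in> {J. J \<subseteq> {1..<n} \<and> I \<union> J = {1..<n}}"
  then have J: "J \<subseteq> {1..<n}" "{1..<n} - J = I - J" "{1..<n} - ({1..<n} - J) = J" "I - (I - J) = I \<inter> J" by auto
  then show "{1..<n} - ({1..<n} - J) = J" by simp
  show "{1..<n} - J \<in> Pow I" using J by auto
  show "of_bool (comp n ({1..<n} - ({1..<n} - J)) = \<gamma>) * (q ^ card ({1..<n} - J) * t ^ card (I - ({1..<n} - J)))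
     = (if comp n J = \<gamma> then q ^ card (I - J) * t ^ card (I \<inter> J) else 0)"
    unfolding J(3) unfolding J(2) J(4) by simp
qed (use assms in auto)

lemma sum_Pow_Un:
  assumes "X \<inter> Y = {}"
  shows "(\<Sum>U\<in>Pow (X \<union> Y). h U) = (\<Sum>V\<in>Pow X. \<Sum>W\<in>Pow Y. h (V \<union> W))"
  unfolding sum.cartesian_product
  by (rule sum.reindex_bij_witness[where i = "\<lambda>(V, W). V \<union> W" and j = "\<lambda>U. (U \<inter> X, U \<inter> Y)"])
    (use assms in \<open>auto intro!: arg_cong[of _ _ h]\<close>)

lemma sum_Pow_powers:
  fixes q t :: "'a::comm_semiring_1"
  assumes "finite X"
  shows "(\<Sum>V\<in>Pow X. q ^ card V * t ^ card (X - V)) = (q + t) ^ card X"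
  \<comment> \<open>Expansion of the product of the factors \<open>q + t\<close> over the elements
    of \<open>X\<close>.\<close>
  using prod_add[OF assms, of "\<lambda>_. q" "\<lambda>_. t"] by simp

text \<open>Since \<open>rank S\<close> is injective on \<open>S\<close>, the sum over subsets of
  the image can be pulled back to positions of the original set, with all cardinalities
  preserved.\<close>

lemma Bcoef_rank:
  assumes S: "S \<subseteq> {1..k}"
  shows "Bcoef q t (card S) (rank S ` (K \<inter> adj k S)) \<gamma> =
    (\<Sum>W\<in>Pow (K \<inter> adj k S). of_bool (comp (card S) ({1..<card S} - rank S ` W) = \<gamma>) *
       (q ^ card W * t ^ card (K \<inter> adj k S - W)))"
proof -
  let ?X = "K \<inter> adj k S"
  have X: "?X \<subseteq> S" by (auto simp: adj_def)
  then have inj: "inj_on (rank S) ?X" using inj_on_rank inj_on_subset by blast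
  have "rank S ` ?X \<subseteq> {1..<card S}" using rank_adj_subset[OF S] by blast
  then have "Bcoef q t (card S) (rank S ` ?X) \<gamma> =
    (\<Sum>U\<in>(`) (rank S) ` Pow ?X. of_bool (comp (card S) ({1..<card S} - U) = \<gamma>) *
       (q ^ card U * t ^ card (rank S ` ?X - U)))"
    by (simp only: Bcoef_Pow image_Pow_surj[OF refl])
  also have "\<dots> = (\<Sum>W\<in>Pow ?X. of_bool (comp (card S) ({1..<card S} - rank S ` W) = \<gamma>) *
       (q ^ card (rank S ` W) * t ^ card (rank S ` ?X - rank S ` W)))"
    by (subst sum.reindex[OF inj_on_image_Pow[OF inj]]) simp
  also have "\<dots> = (\<Sum>W\<in>Pow ?X. of_bool (comp (card S) ({1..<card S} - rank S ` W) = \<gamma>) *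
       (q ^ card W * t ^ card (?X - W)))"
  proof (intro sum.cong refl)
    fix W assume W: "W \<in> Pow ?X"
    then have "rank S ` ?X - rank S ` W = rank S ` (?X - W)"
      using inj_on_image_set_diff[OF inj, of ?X W] by auto
    moreover have "card (rank S ` W) = card W" "card (rank S ` (?X - W)) = card (?X - W)"
      using W inj by (auto intro!: card_image intro: inj_on_subset)
    ultimately show "of_bool (comp (card S) ({1..<card S} - rank S ` W) = \<gamma>) *
       (q ^ card (rank S ` W) * t ^ card (rank S ` ?X - rank S ` W)) =
       of_bool (comp (card S) ({1..<card S} - rank S ` W) = \<gamma>) * (q ^ card W * t ^ card (?X - W))"
      by simp
  qed
  finally show ?thesis .
qed

section \<open>The coproduct\<close>

text \<open>The total contribution of one \<open>A\<close> to the coproduct, written without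
  inverses: the powers of \<open>t\<close> for positions outside \<open>c1\<close> and
  \<open>c2\<close> are already inside the two \<open>Bcoef\<close> factors.\<close>

definition shuffle_term :: "cqt \<Rightarrow> cqt \<Rightarrow> nat \<Rightarrow> nat set \<Rightarrow> nat set \<Rightarrow> nat list \<Rightarrow> nat list \<Rightarrow> cqt" where
  "shuffle_term q t k K A \<beta> \<gamma> = (let A' = {1..k} - A in
     (q + t) ^ card (K \<inter> c2 k A) * t ^ card (K \<inter> c1 k A) *
     Bcoef q t (card A') (rank A' ` (K \<inter> adj k A')) \<beta> *
     Bcoef q t (card A) (rank A ` (K \<inter> adj k A)) \<gamma>)"

lemma sum_uncut_eq_shuffle_term:
  assumes K: "K \<subseteq> {1..<k}" and A: "A \<subseteq> {1..k}"
  defines "A' \<equiv> {1..k} - A"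
  shows "(\<Sum>U\<in>Pow K. q ^ card U * t ^ card (K - U) *
      of_bool (c1 k A \<subseteq> {1..<k} - U \<and>
        comp (card A') (rank A' ` ({1..<k} - U) - {0, card A'}) = \<beta> \<and>
        comp (card A) (rank A ` ({1..<k} - U) - {0, card A}) = \<gamma>)) = shuffle_term q t k K A \<beta> \<gamma>"
proof -
  define X where "X = K \<inter> c2 k A"
  define Y where "Y = K \<inter> adj k A'"
  define Z where "Z = K \<inter> adj k A"
  define C where "C = K \<inter> c1 k A"
  define F where "F W = (of_bool (comp (card A') ({1..<card A'} - rank A' ` W) = \<beta>) :: cqt)" for W
  define G where "G W = (of_bool (comp (card A) ({1..<card A} - rank A ` W) = \<gamma>) :: cqt)" for W
  have fin: "finite K" using K finite_subset by blast
  have c1_sub: "c1 k A \<subseteq> {1..<k}" using A by (auto simp: c1_eq)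
  have disj: "C \<inter> X = {}" "C \<inter> Y = {}" "C \<inter> Z = {}" "X \<inter> (Y \<union> Z) = {}" "Y \<inter> Z = {}"
    using A by (auto simp: X_def Y_def Z_def C_def c1_eq c2_eq adj_def A'_def)
  have un: "K = C \<union> (X \<union> (Y \<union> Z))"
    using A K by (auto simp: X_def Y_def Z_def C_def c1_eq c2_eq adj_def A'_def)
  have "(\<Sum>U\<in>Pow K. q ^ card U * t ^ card (K - U) *
      of_bool (c1 k A \<subseteq> {1..<k} - U \<and>
        comp (card A') (rank A' ` ({1..<k} - U) - {0, card A'}) = \<beta> \<and>
        comp (card A) (rank A ` ({1..<k} - U) - {0, card A}) = \<gamma>)) =
     (\<Sum>U\<in>Pow (X \<union> (Y \<union> Z)). q ^ card U * t ^ card (K - U) *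
      (F (U \<inter> Y) * G (U \<inter> Z)))"
  \<comment> \<open>A set \<open>U\<close> meeting \<open>C\<close> violates the condition on
    \<open>c1\<close> and contributes zero. For the others the left factor depends only on
    \<open>U \<inter> Y\<close> and the right one only on \<open>U \<inter> Z\<close>.\<close>
  proof (rule sum.mono_neutral_cong_right)
    show "finite (Pow K)" using fin by simp
    show "Pow (X \<union> (Y \<union> Z)) \<subseteq> Pow K" using un by blast
    show "\<forall>U\<in>Pow K - Pow (X \<union> (Y \<union> Z)). q ^ card U * t ^ card (K - U) *
      of_bool (c1 k A \<subseteq> {1..<k} - U \<and>
        comp (card A') (rank A' ` ({1..<k} - U) - {0, card A'}) = \<beta> \<and>
        comp (card A) (rank A ` ({1..<k} - U) - {0, card A}) = \<gamma>) = 0"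
    proof
      fix U assume "U \<in> Pow K - Pow (X \<union> (Y \<union> Z))"
      then obtain u where "u \<in> U" "u \<in> C" using un by blast
      then have "\<not> c1 k A \<subseteq> {1..<k} - U" unfolding C_def by blast
      then show "q ^ card U * t ^ card (K - U) *
      of_bool (c1 k A \<subseteq> {1..<k} - U \<and>
        comp (card A') (rank A' ` ({1..<k} - U) - {0, card A'}) = \<beta> \<and>
        comp (card A) (rank A ` ({1..<k} - U) - {0, card A}) = \<gamma>) = 0" by simp
    qed
    fix U assume U: "U \<in> Pow (X \<union> (Y \<union> Z))"
    then have UK: "U \<subseteq> K" using un by blast
    have "U \<inter> C = {}" using U disj by blast
    then have Uc: "U \<inter> c1 k A = {}" using UK unfolding C_def by blast
    have Uk: "U \<subseteq> {1..<k}" using UK K by blast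
    have "U \<inter> adj k A' = U \<inter> Y" "U \<inter> adj k A = U \<inter> Z" using UK unfolding Y_def Z_def by blast+
    then have r: "rank A' ` ({1..<k} - U) - {0, card A'} = {1..<card A'} - rank A' ` (U \<inter> Y)"
      "rank A ` ({1..<k} - U) - {0, card A} = {1..<card A} - rank A ` (U \<inter> Z)"
      using rank_uncut_left[OF A Uk Uc] rank_uncut_right[OF A Uk Uc] unfolding A'_def by simp_all
    have "c1 k A \<subseteq> {1..<k} - U" using Uc c1_sub by blast
    then show "q ^ card U * t ^ card (K - U) *
      of_bool (c1 k A \<subseteq> {1..<k} - U \<and>
        comp (card A') (rank A' ` ({1..<k} - U) - {0, card A'}) = \<beta> \<and>
        comp (card A) (rank A ` ({1..<k} - U) - {0, card A}) = \<gamma>) =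
      q ^ card U * t ^ card (K - U) * (F (U \<inter> Y) * G (U \<inter> Z))"
      unfolding r F_def G_def by simp
  qed
  \<comment> \<open>Split \<open>U\<close> into its parts \<open>V\<close>, \<open>W\<close>,
    \<open>T\<close> in \<open>X\<close>, \<open>Y\<close>, \<open>Z\<close>. Both exponents are
    additive over the pieces, and all of \<open>C\<close> counts towards the exponent of
    \<open>t\<close>; \<open>V\<close> enters through its weight alone.\<close>
  also have "\<dots> = (\<Sum>V\<in>Pow X. \<Sum>W\<in>Pow Y. \<Sum>T\<in>Pow Z.
      t ^ card C * (q ^ card V * t ^ card (X - V)) *
      ((F W * (q ^ card W * t ^ card (Y - W))) * (G T * (q ^ card T * t ^ card (Z - T)))))"
    unfolding sum_Pow_Un[OF disj(4)] sum_Pow_Un[OF disj(5)]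
  proof (intro sum.cong refl)
    fix V W T assume VWT: "V \<in> Pow X" "W \<in> Pow Y" "T \<in> Pow Z"
    have fins: "finite C" "finite X" "finite Y" "finite Z" using fin un by (auto intro: finite_subset)
    then have finV: "finite V" "finite W" "finite T" using VWT finite_subset by blast+
    have "V \<inter> (W \<union> T) = {}" "W \<inter> T = {}" using VWT disj by blast+
    then have c: "card (V \<union> (W \<union> T)) = card V + (card W + card T)"
      using finV by (simp add: card_Un_disjoint)
    have "K - (V \<union> (W \<union> T)) = C \<union> ((X - V) \<union> ((Y - W) \<union> (Z - T)))"
      using un disj VWT by blast
    moreover have "C \<inter> ((X - V) \<union> ((Y - W) \<union> (Z - T))) = {}" "(X - V) \<inter> ((Y - W) \<union> (Z - T)) = {}"
      "(Y - W) \<inter> (Z - T) = {}" using disj by blast+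
    ultimately have d: "card (K - (V \<union> (W \<union> T))) = card C + (card (X - V) + (card (Y - W) + card (Z - T)))"
      using fins by (simp add: card_Un_disjoint)
    have e: "(V \<union> (W \<union> T)) \<inter> Y = W" "(V \<union> (W \<union> T)) \<inter> Z = T"
      using VWT disj by blast+
    show "q ^ card (V \<union> (W \<union> T)) * t ^ card (K - (V \<union> (W \<union> T))) *
        (F ((V \<union> (W \<union> T)) \<inter> Y) * G ((V \<union> (W \<union> T)) \<inter> Z)) =
      t ^ card C * (q ^ card V * t ^ card (X - V)) *
      ((F W * (q ^ card W * t ^ card (Y - W))) * (G T * (q ^ card T * t ^ card (Z - T))))"
      unfolding c d e power_add by (simp only: mult_ac)
  qed
  also have "\<dots> = t ^ card C * (\<Sum>V\<in>Pow X. q ^ card V * t ^ card (X - V)) *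
      ((\<Sum>W\<in>Pow Y. F W * (q ^ card W * t ^ card (Y - W))) *
       (\<Sum>T\<in>Pow Z. G T * (q ^ card T * t ^ card (Z - T))))"
    by (simp only: sum_distrib_left[symmetric] sum_distrib_right[symmetric])
  also have "(\<Sum>V\<in>Pow X. q ^ card V * t ^ card (X - V)) = (q + t) ^ card X"
    using fin by (intro sum_Pow_powers) (simp add: X_def)
  also have "(\<Sum>W\<in>Pow Y. F W * (q ^ card W * t ^ card (Y - W))) =
      Bcoef q t (card A') (rank A' ` Y) \<beta>"
    unfolding Y_def F_def by (rule Bcoef_rank[symmetric]) (auto simp: A'_def)
  also have "(\<Sum>T\<in>Pow Z. G T * (q ^ card T * t ^ card (Z - T))) =
      Bcoef q t (card A) (rank A ` Z) \<gamma>"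
    unfolding Z_def G_def by (rule Bcoef_rank[symmetric]) (rule A)
  finally show ?thesis
    unfolding shuffle_term_def Let_def X_def Y_def Z_def C_def A'_def by (simp only: mult_ac)
qed

section \<open>Expanding the coproduct over subsets\<close>

lemma finite_comps: "finite {\<alpha>. is_comp \<alpha> \<and> sum_list \<alpha> = s}"
proof (rule finite_subset)
  show "{\<alpha>. is_comp \<alpha> \<and> sum_list \<alpha> = s} \<subseteq> comp s ` Pow {1..<s}"
  proof
    fix \<alpha> assume "\<alpha> \<in> {\<alpha>. is_comp \<alpha> \<and> sum_list \<alpha> = s}"
    then show "\<alpha> \<in> comp s ` Pow {1..<s}"
      using comp_set_of_comp[of \<alpha>] set_of_comp_subset[of \<alpha>] by (intro image_eqI[of _ _ "set_of_comp \<alpha>"]) auto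
  qed
qed simp

text \<open>The two restrictions have sizes \<open>k - card A\<close> and \<open>card A\<close>.
  This homogeneity reconciles the size condition in \<open>nsym_coprod\<close>, taken from
  \<open>\<beta>\<close> and \<open>\<gamma>\<close>, with the degree \<open>k\<close>.\<close>

lemma deltaH_comp_eq_0:
  assumes "L \<subseteq> {1..<k}" "k \<noteq> sum_list \<beta> + sum_list \<gamma>"
  shows "deltaH (comp k L) \<beta> \<gamma> = 0"
proof -
  have "\<not> (comp (k - card A) (rank ({1..k} - A) ` L - {0, k - card A}) = \<beta> \<and>
     comp (card A) (rank A ` L - {0, card A}) = \<gamma>)" if A: "A \<subseteq> {1..k}" for A
  proof
    assume *: "comp (k - card A) (rank ({1..k} - A) ` L - {0, k - card A}) = \<beta> \<and>
     comp (card A) (rank A ` L - {0, card A}) = \<gamma>"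
    have fin: "finite A" using A finite_subset by blast
    have "card ({1..k} - A) = k - card A" using A fin by (simp add: card_Diff_subset)
    then have "sum_list \<beta> = k - card A" "sum_list \<gamma> = card A"
      using * rank_cuts_subset[of "{1..k} - A" L] rank_cuts_subset[OF fin, of L]
        sum_list_comp by (metis finite_Diff finite_atLeastAtMost)+
    moreover have "card A \<le> k" using card_mono[OF _ A] by simp
    ultimately show False using assms(2) by simp
  qed
  then have "{A. A \<subseteq> {1..k} \<and> c1 k A \<subseteq> L \<and>
     comp (k - card A) (rank ({1..k} - A) ` L - {0, k - card A}) = \<beta> \<and>
     comp (card A) (rank A ` L - {0, card A}) = \<gamma>} = {}" by blast
  then show ?thesis unfolding deltaH_comp[OF assms(1)] by (simp only: card.empty)
qed

lemma nsym_coprod_Bcoef: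
  assumes K: "K \<subseteq> {1..<k}"
  shows "nsym_coprod (Bcoef q t k K) (\<beta>, \<gamma>) =
    (\<Sum>U\<in>Pow K. q ^ card U * t ^ card (K - U) * of_nat (deltaH (comp k ({1..<k} - U)) \<beta> \<gamma>))"
proof -
  let ?s = "sum_list \<beta> + sum_list \<gamma>"
  let ?C = "{\<alpha>. is_comp \<alpha> \<and> sum_list \<alpha> = ?s}"
  let ?w = "\<lambda>U. q ^ card U * t ^ card (K - U)"
  let ?c = "\<lambda>U. comp k ({1..<k} - U)"
  have "nsym_coprod (Bcoef q t k K) (\<beta>, \<gamma>) =
    (\<Sum>\<alpha>\<in>?C. \<Sum>U\<in>Pow K. of_bool (?c U = \<alpha>) * ?w U * of_nat (deltaH \<alpha> \<beta> \<gamma>))"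
    by (simp only: nsym_coprod_def case_prod_conv Bcoef_Pow[OF K] sum_distrib_right)
  also have "\<dots> = (\<Sum>U\<in>Pow K. \<Sum>\<alpha>\<in>?C. of_bool (?c U = \<alpha>) * ?w U * of_nat (deltaH \<alpha> \<beta> \<gamma>))"
    by (rule sum.swap)
  also have "\<dots> = (\<Sum>U\<in>Pow K. ?w U * of_nat (deltaH (?c U) \<beta> \<gamma>))"
  proof (rule sum.cong)
    fix U assume "U \<in> Pow K"
    have sub: "{1..<k} - U \<subseteq> {1..<k}" by blast
    have "(\<Sum>\<alpha>\<in>?C. of_bool (?c U = \<alpha>) * ?w U * of_nat (deltaH \<alpha> \<beta> \<gamma>)) =
        (\<Sum>\<alpha>\<in>?C. if ?c U = \<alpha> then ?w U * of_nat (deltaH \<alpha> \<beta> \<gamma>) else 0)"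
      by (intro sum.cong) auto
    also have "\<dots> = (if ?c U \<in> ?C then ?w U * of_nat (deltaH (?c U) \<beta> \<gamma>) else 0)"
      by (rule sum.delta'[OF finite_comps])
    also have "\<dots> = ?w U * of_nat (deltaH (?c U) \<beta> \<gamma>)"
      using deltaH_comp_eq_0[OF sub, of \<beta> \<gamma>] is_comp_comp[OF sub] sum_list_comp[OF sub] by auto
    finally show "(\<Sum>\<alpha>\<in>?C. of_bool (?c U = \<alpha>) * ?w U * of_nat (deltaH \<alpha> \<beta> \<gamma>)) = \<dots>" .
  qed simp
  finally show ?thesis .
qed

text \<open>Each \<open>deltaH\<close> is a number of sets \<open>A\<close>, hence a sum of
  indicators; exchanging it with the sum over \<open>U\<close> leaves for each \<open>A\<close> the
  sum already evaluated.\<close>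

lemma nsym_coprod_eq_sum_shuffle_term:
  assumes K: "K \<subseteq> {1..<k}"
  shows "nsym_coprod (Bcoef q t k K) (\<beta>, \<gamma>) = (\<Sum>A\<in>Pow {1..k}. shuffle_term q t k K A \<beta> \<gamma>)"
proof -
  let ?w = "\<lambda>U. q ^ card U * t ^ card (K - U)"
  define P where "P A U \<longleftrightarrow> c1 k A \<subseteq> {1..<k} - U \<and>
    comp (card ({1..k} - A)) (rank ({1..k} - A) ` ({1..<k} - U) - {0, card ({1..k} - A)}) = \<beta> \<and>
    comp (card A) (rank A ` ({1..<k} - U) - {0, card A}) = \<gamma>" for A U
  have card_compl: "card ({1..k} - A) = k - card A" if "A \<subseteq> {1..k}" for A
    using that by (simp add: card_Diff_subset finite_subset)
  have "of_nat (deltaH (comp k ({1..<k} - U)) \<beta> \<gamma>) = (\<Sum>A\<in>Pow {1..k}. of_bool (P A U) :: cqt)" for U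
  proof -
    have sub: "{1..<k} - U \<subseteq> {1..<k}" by blast
    have "deltaH (comp k ({1..<k} - U)) \<beta> \<gamma> = card (Pow {1..k} \<inter> {A. P A U})"
      unfolding deltaH_comp[OF sub]
    proof (rule arg_cong[of _ _ card], intro set_eqI iffI)
      fix A assume "A \<in> Pow {1..k} \<inter> {A. P A U}"
      then show "A \<in> {A. A \<subseteq> {1..k} \<and> c1 k A \<subseteq> {1..<k} - U \<and>
          comp (k - card A) (rank ({1..k} - A) ` ({1..<k} - U) - {0, k - card A}) = \<beta> \<and>
          comp (card A) (rank A ` ({1..<k} - U) - {0, card A}) = \<gamma>}"
        using card_compl[of A] by (simp only: P_def mem_Collect_eq Int_iff Pow_iff)
    next
      fix A assume "A \<in> {A. A \<subseteq> {1..k} \<and> c1 k A \<subseteq> {1..<k} - U \<and>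
          comp (k - card A) (rank ({1..k} - A) ` ({1..<k} - U) - {0, k - card A}) = \<beta> \<and>
          comp (card A) (rank A ` ({1..<k} - U) - {0, card A}) = \<gamma>}"
      then show "A \<in> Pow {1..k} \<inter> {A. P A U}"
        using card_compl[of A] by (simp only: P_def mem_Collect_eq Int_iff Pow_iff)
    qed
    then show ?thesis by simp
  qed
  then have "nsym_coprod (Bcoef q t k K) (\<beta>, \<gamma>) =
      (\<Sum>U\<in>Pow K. \<Sum>A\<in>Pow {1..k}. ?w U * of_bool (P A U))"
    by (simp only: nsym_coprod_Bcoef[OF K] sum_distrib_left)
  also have "\<dots> = (\<Sum>A\<in>Pow {1..k}. \<Sum>U\<in>Pow K. ?w U * of_bool (P A U))"
    by (rule sum.swap)
  also have "\<dots> = (\<Sum>A\<in>Pow {1..k}. shuffle_term q t k K A \<beta> \<gamma>)"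
    unfolding P_def using sum_uncut_eq_shuffle_term[OF K] by (intro sum.cong) auto
  finally show ?thesis .
qed

text \<open>For given \<open>A\<close> the pair \<open>I\<close>, \<open>J\<close> is unique: the
  two images in \<open>sharp\<close> lie in disjoint sets, so they can be compared separately, and
  on each of these sets \<open>rank\<close> inverts \<open>nth_elem\<close>.\<close>

lemma sharp_eq_iff:
  assumes A: "A \<subseteq> {1..k}" and K: "K \<subseteq> {1..<k}"
    and I: "I \<subseteq> {1..<card ({1..k} - A)}" and J: "J \<subseteq> {1..<card A}"
  shows "sharp k A I J = K - cc k A \<longleftrightarrow>
    I = rank ({1..k} - A) ` (K \<inter> adj k ({1..k} - A)) \<and> J = rank A ` (K \<inter> adj k A)"
proof -
  let ?A' = "{1..k} - A"
  have A': "?A' \<subseteq> {1..k}" by blast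
  have cc: "K - cc k A = (K \<inter> adj k ?A') \<union> (K \<inter> adj k A)"
    using A K by (auto simp: cc_def c1_eq c2_eq adj_def)
  have img: "nth_elem S ` X = Y \<longleftrightarrow> X = rank S ` Y"
    if S: "S \<subseteq> {1..k}" and X: "X \<subseteq> {1..<card S}" and Y: "Y \<subseteq> S" for S X Y
  proof -
    have "rank S ` nth_elem S ` X = X"
      unfolding image_image using rank_nth_elem[OF S] X by (force simp: subset_iff)
    moreover have "nth_elem S ` rank S ` Y = Y"
      unfolding image_image using nth_elem_rank[OF S] Y by (force simp: subset_iff)
    ultimately show ?thesis by blast
  qed
  have sub: "nth_elem ?A' ` I \<subseteq> ?A'" "nth_elem A ` J \<subseteq> A"
    using nth_elem_in[OF A'] nth_elem_in[OF A] I J by force+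
  have "sharp k A I J = K - cc k A \<longleftrightarrow>
    nth_elem ?A' ` I = K \<inter> adj k ?A' \<and> nth_elem A ` J = K \<inter> adj k A"
  proof -
    have "adj k ?A' \<subseteq> ?A'" "adj k A \<subseteq> A" by (auto simp: adj_def)
    then show ?thesis unfolding sharp_def cc using sub by blast
  qed
  moreover have "K \<inter> adj k ?A' \<subseteq> ?A'" "K \<inter> adj k A \<subseteq> A" by (auto simp: adj_def)
  ultimately show ?thesis using img[OF A' I] img[OF A J] by simp
qed

lemma sum_Ccoef:
  assumes K: "K \<subseteq> {1..<k}" and m: "m \<le> k" and t: "t \<noteq> 0"
  shows "(\<Sum>I\<in>Pow {1..<m}. \<Sum>J\<in>Pow {1..<k - m}.
      Ccoef q t m (k - m) K I J * Bcoef q t m I \<beta> * Bcoef q t (k - m) J \<gamma>) =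
    (\<Sum>A\<in>{A \<in> Pow {1..k}. k - card A = m}. shuffle_term q t k K A \<beta> \<gamma>)"
proof -
  let ?S = "{A \<in> Pow {1..k}. k - card A = m}"
  define I0 where "I0 A = rank ({1..k} - A) ` (K \<inter> adj k ({1..k} - A))" for A
  define J0 where "J0 A = rank A ` (K \<inter> adj k A)" for A
  define w where "w A = (q + t) ^ card (K \<inter> c2 k A) * t ^ card (K - c2 k A)" for A
  define g where "g I J = inverse (t ^ (card I + card J)) * Bcoef q t m I \<beta> * Bcoef q t (k - m) J \<gamma>" for I J
  have S: "A \<subseteq> {1..k}" "card ({1..k} - A) = m" "card A = k - m" if "A \<in> ?S" for A
  proof -
    show A: "A \<subseteq> {1..k}" using that by blast
    have "card A \<le> k" using card_mono[OF _ A] by simp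
    then show "card A = k - m" using that by auto
    show "card ({1..k} - A) = m" using A that by (simp add: card_Diff_subset finite_subset)
  qed
  have C: "Ccoef q t m (k - m) K I J * Bcoef q t m I \<beta> * Bcoef q t (k - m) J \<gamma> =
      (\<Sum>A\<in>?S. if I = I0 A \<and> J = J0 A then g I J * w A else 0)"
    if I: "I \<in> Pow {1..<m}" and J: "J \<in> Pow {1..<k - m}" for I J
  proof -
    \<comment> \<open>Being disjoint from \<open>cc\<close>, contained in \<open>K\<close>, and
      covering \<open>K\<close> together with \<open>cc\<close> amounts to the single equation
      \<open>sharp k A I J = K - cc k A\<close>.\<close>
    have "{A. A \<subseteq> {1..m + (k - m)} \<and> card A = k - m \<and>
        sharp (m + (k - m)) A I J \<inter> cc (m + (k - m)) A = {} \<and>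
        sharp (m + (k - m)) A I J \<subseteq> K \<and> K \<subseteq> sharp (m + (k - m)) A I J \<union> cc (m + (k - m)) A} =
      {A \<in> ?S. sharp k A I J = K - cc k A}"
    proof -
      have "card A = k - m \<longleftrightarrow> k - card A = m" if "A \<subseteq> {1..k}" for A
        using card_mono[OF _ that] m by auto
      then show ?thesis using m by auto
    qed
    also have "\<dots> = {A \<in> ?S. I = I0 A \<and> J = J0 A}"
    proof (rule Collect_cong, rule conj_cong[OF refl])
      fix A assume "A \<in> ?S"
      note A = S[OF this]
      show "sharp k A I J = K - cc k A \<longleftrightarrow> I = I0 A \<and> J = J0 A"
        unfolding I0_def J0_def using sharp_eq_iff[OF A(1) K, of I J] I J
        unfolding A(2,3) by blast
    qed
    finally have "Ccoef q t m (k - m) K I J =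
      inverse (t ^ (card I + card J)) * (\<Sum>A\<in>{A \<in> ?S. I = I0 A \<and> J = J0 A}. w A)"
      using m by (simp add: Ccoef_def w_def)
    then have "Ccoef q t m (k - m) K I J * Bcoef q t m I \<beta> * Bcoef q t (k - m) J \<gamma> =
      (\<Sum>A\<in>{A \<in> ?S. I = I0 A \<and> J = J0 A}. g I J * w A)"
      by (simp add: g_def sum_distrib_left mult_ac)
    also have "\<dots> = (\<Sum>A\<in>?S. if I = I0 A \<and> J = J0 A then g I J * w A else 0)"
      by (intro sum.inter_filter) simp
    finally show ?thesis .
  qed
  have "(\<Sum>I\<in>Pow {1..<m}. \<Sum>J\<in>Pow {1..<k - m}.
      Ccoef q t m (k - m) K I J * Bcoef q t m I \<beta> * Bcoef q t (k - m) J \<gamma>) =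
    (\<Sum>I\<in>Pow {1..<m}. \<Sum>J\<in>Pow {1..<k - m}. \<Sum>A\<in>?S. if I = I0 A \<and> J = J0 A then g I J * w A else 0)"
    by (intro sum.cong refl C)
  also have "\<dots> = (\<Sum>(I, J)\<in>Pow {1..<m} \<times> Pow {1..<k - m}.
      \<Sum>A\<in>?S. if I = I0 A \<and> J = J0 A then g I J * w A else 0)"
    by (rule sum.cartesian_product)
  \<comment> \<open>Pairing \<open>I\<close> with \<open>J\<close> makes the inner condition an
    equation for one variable, so after the exchange of sums only one term survives for each
    \<open>A\<close>.\<close>
  also have "\<dots> = (\<Sum>p\<in>Pow {1..<m} \<times> Pow {1..<k - m}.
      \<Sum>A\<in>?S. if p = (I0 A, J0 A) then g (fst p) (snd p) * w A else 0)"
    by (intro sum.cong refl) (auto intro!: sum.cong)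
  also have "\<dots> = (\<Sum>A\<in>?S. \<Sum>p\<in>Pow {1..<m} \<times> Pow {1..<k - m}. if p = (I0 A, J0 A) then g (fst p) (snd p) * w A else 0)"
    by (rule sum.swap)
  also have "\<dots> = (\<Sum>A\<in>?S. shuffle_term q t k K A \<beta> \<gamma>)"
  proof (rule sum.cong[OF refl])
    fix A assume "A \<in> ?S"
    note A = S[OF this]
    let ?A' = "{1..k} - A"
    have A': "?A' \<subseteq> {1..k}" by blast
    have "I0 A \<subseteq> {1..<m}" "J0 A \<subseteq> {1..<k - m}"
      using rank_adj_subset[OF A'] rank_adj_subset[OF A(1)] unfolding I0_def J0_def A(2,3) by blast+
    then have "(\<Sum>p\<in>Pow {1..<m} \<times> Pow {1..<k - m}. if p = (I0 A, J0 A) then g (fst p) (snd p) * w A else 0)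
       = g (I0 A) (J0 A) * w A"
      by (subst sum.delta) auto
    also have "\<dots> = shuffle_term q t k K A \<beta> \<gamma>"
    proof -
      have fin: "finite K" using K finite_subset by blast
      have "card (I0 A) = card (K \<inter> adj k ?A')" "card (J0 A) = card (K \<inter> adj k A)"
        unfolding I0_def J0_def
        by (rule card_image, rule inj_on_subset[OF inj_on_rank], auto simp: adj_def)+
      \<comment> \<open>The positions outside \<open>c1\<close> number
        \<open>card (I0 A) + card (J0 A)\<close>, exactly the exponent that the inverse power of
        \<open>t\<close> in \<open>Ccoef\<close> cancels.\<close>
      moreover have "K - c2 k A = (K \<inter> c1 k A) \<union> ((K \<inter> adj k ?A') \<union> (K \<inter> adj k A))"
        using A(1) K by (auto simp: c1_eq c2_eq adj_def)
      moreover have "(K \<inter> c1 k A) \<inter> ((K \<inter> adj k ?A') \<union> (K \<inter> adj k A)) = {}"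
        "(K \<inter> adj k ?A') \<inter> (K \<inter> adj k A) = {}"
        using A(1) by (auto simp: c1_eq adj_def)
      ultimately have "card (K - c2 k A) = card (K \<inter> c1 k A) + (card (I0 A) + card (J0 A))"
        using fin by (simp add: card_Un_disjoint)
      then have "w A = (q + t) ^ card (K \<inter> c2 k A) * (t ^ card (K \<inter> c1 k A) * t ^ (card (I0 A) + card (J0 A)))"
        by (simp add: w_def power_add)
      moreover have "inverse (t ^ (card (I0 A) + card (J0 A))) * t ^ (card (I0 A) + card (J0 A)) = 1"
        using t by simp
      ultimately have "g (I0 A) (J0 A) * w A = (q + t) ^ card (K \<inter> c2 k A) * t ^ card (K \<inter> c1 k A) *
          Bcoef q t m (I0 A) \<beta> * Bcoef q t (k - m) (J0 A) \<gamma>"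
        unfolding g_def by (simp add: algebra_simps)
      then show ?thesis
        unfolding shuffle_term_def Let_def A(2,3) I0_def J0_def .
    qed
    finally show "(\<Sum>p\<in>Pow {1..<m} \<times> Pow {1..<k - m}. if p = (I0 A, J0 A) then g (fst p) (snd p) * w A else 0)
       = shuffle_term q t k K A \<beta> \<gamma>" .
  qed
  finally show ?thesis .
qed

text \<open>The sets \<open>A\<close> are grouped by the size \<open>m = k - card A\<close> of their
  complement, which is the degree of the left tensor factor.\<close>

lemma nsym_coprod_Bcoef_eq_sum_Ccoef:
  assumes K: "K \<subseteq> {1..<k}" and t: "t \<noteq> 0"
  shows "nsym_coprod (Bcoef q t k K) (\<beta>, \<gamma>) =
    (\<Sum>m\<in>{0..k}. \<Sum>I\<in>Pow {1..<m}. \<Sum>J\<in>Pow {1..<k - m}.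
       Ccoef q t m (k - m) K I J * Bcoef q t m I \<beta> * Bcoef q t (k - m) J \<gamma>)"
proof -
  have "(\<Sum>m\<in>{0..k}. \<Sum>I\<in>Pow {1..<m}. \<Sum>J\<in>Pow {1..<k - m}.
       Ccoef q t m (k - m) K I J * Bcoef q t m I \<beta> * Bcoef q t (k - m) J \<gamma>) =
    (\<Sum>m\<in>{0..k}. \<Sum>A\<in>{A \<in> Pow {1..k}. k - card A = m}. shuffle_term q t k K A \<beta> \<gamma>)"
    by (intro sum.cong refl sum_Ccoef K t) simp
  also have "\<dots> = (\<Sum>A\<in>Pow {1..k}. shuffle_term q t k K A \<beta> \<gamma>)"
    by (rule sum.group) auto
  finally show ?thesis by (simp add: nsym_coprod_eq_sum_shuffle_term[OF K])
qed

section \<open>The product\<close>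

lemma psum_append_left: "i \<le> length \<alpha> \<Longrightarrow> psum (\<alpha> @ \<beta>) i = psum \<alpha> i"
  by (simp add: psum_def)

lemma psum_append_right: "psum (\<alpha> @ \<beta>) (length \<alpha> + j) = sum_list \<alpha> + psum \<beta> j"
  by (simp add: psum_def)

lemma set_of_comp_append:
  assumes "\<alpha> \<noteq> []" "\<beta> \<noteq> []"
  shows "set_of_comp (\<alpha> @ \<beta>) = set_of_comp \<alpha> \<union> {sum_list \<alpha>} \<union> (+) (sum_list \<alpha>) ` set_of_comp \<beta>"
proof -
  have "{0<..<length (\<alpha> @ \<beta>)} =
      {0<..<length \<alpha>} \<union> {length \<alpha>} \<union> (+) (length \<alpha>) ` {0<..<length \<beta>}"
  proof (intro equalityI subsetI)
    fix i assume i: "i \<in> {0<..<length (\<alpha> @ \<beta>)}"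
    show "i \<in> {0<..<length \<alpha>} \<union> {length \<alpha>} \<union> (+) (length \<alpha>) ` {0<..<length \<beta>}"
    proof (cases "length \<alpha> < i")
      case True
      then have "i = length \<alpha> + (i - length \<alpha>)" "i - length \<alpha> \<in> {0<..<length \<beta>}" using i by auto
      then show ?thesis by blast
    qed (use i in auto)
  qed (use assms in auto)
  moreover have "psum (\<alpha> @ \<beta>) ` {0<..<length \<alpha>} = set_of_comp \<alpha>"
    unfolding set_of_comp_eq by (intro image_cong) (auto simp: psum_append_left)
  moreover have "psum (\<alpha> @ \<beta>) (length \<alpha>) = sum_list \<alpha>"
    using psum_append_right[of \<alpha> \<beta> 0] by simp
  moreover have "psum (\<alpha> @ \<beta>) ` (+) (length \<alpha>) ` {0<..<length \<beta>} = (+) (sum_list \<alpha>) ` set_of_comp \<beta>"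
    unfolding set_of_comp_eq image_image psum_append_right ..
  ultimately show ?thesis
    unfolding set_of_comp_eq[of "\<alpha> @ \<beta>"] by (simp only: image_Un image_insert image_empty)
qed

section \<open>Near-concatenation\<close>

lemma odot_Nil [simp]: "odot [] \<beta> = \<beta>" "odot \<alpha> [] = \<alpha>"
  by (auto simp: odot_def)

lemma sum_list_odot: "sum_list (odot \<alpha> \<beta>) = sum_list \<alpha> + sum_list \<beta>"
  by (cases \<alpha> rule: rev_cases; cases \<beta>) (auto simp: odot_def)

text \<open>Fusing the last part of \<open>\<alpha>\<close> with the first part of
  \<open>\<beta>\<close> removes the junction \<open>sum_list \<alpha>\<close> from the cuts of
  \<open>\<alpha> @ \<beta>\<close> and changes no other partial sum.\<close>

lemma set_of_comp_odot:
  assumes "\<alpha> \<noteq> []" "\<beta> \<noteq> []"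
  shows "set_of_comp (odot \<alpha> \<beta>) = set_of_comp \<alpha> \<union> (+) (sum_list \<alpha>) ` set_of_comp \<beta>"
proof -
  obtain \<alpha>' x where \<alpha>: "\<alpha> = \<alpha>' @ [x]" using assms(1) by (cases \<alpha> rule: rev_cases) auto
  obtain y \<beta>' where \<beta>: "\<beta> = y # \<beta>'" using assms(2) by (cases \<beta>) auto
  have odot: "odot \<alpha> \<beta> = \<alpha>' @ (x + y) # \<beta>'" by (simp add: odot_def \<alpha> \<beta>)
  have left: "psum (odot \<alpha> \<beta>) i = psum \<alpha> i" if "i \<le> length \<alpha>'" for i
    unfolding odot unfolding \<alpha> using that by (simp add: psum_append_left)
  \<comment> \<open>The fused entry already contains the first part of \<open>\<beta>\<close>, so
    the index shift is \<open>length \<alpha>'\<close>, one less than the length of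
    \<open>\<alpha>\<close>.\<close>
  have right: "psum (odot \<alpha> \<beta>) (length \<alpha>' + j) = sum_list \<alpha> + psum \<beta> j" if "0 < j" for j
    unfolding odot unfolding \<alpha> \<beta> using that by (cases j) (simp_all add: psum_def)
  have length_\<alpha>: "length \<alpha> = Suc (length \<alpha>')" by (simp add: \<alpha>)
  have len: "length (odot \<alpha> \<beta>) = length \<alpha>' + length \<beta>"
    unfolding odot unfolding \<beta> by simp
  have "{0<..<length (odot \<alpha> \<beta>)} = {0<..<length \<alpha>} \<union> (+) (length \<alpha>') ` {0<..<length \<beta>}"
  proof (intro equalityI subsetI)
    fix i assume i: "i \<in> {0<..<length (odot \<alpha> \<beta>)}"
    show "i \<in> {0<..<length \<alpha>} \<union> (+) (length \<alpha>') ` {0<..<length \<beta>}"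
    proof (cases "length \<alpha>' < i")
      case True
      then have "i = length \<alpha>' + (i - length \<alpha>')" "i - length \<alpha>' \<in> {0<..<length \<beta>}"
        using i len by auto
      then show ?thesis by blast
    qed (use i in \<open>auto simp: \<alpha>\<close>)
  qed (use len in \<open>auto simp: \<alpha> \<beta>\<close>)
  moreover have "psum (odot \<alpha> \<beta>) ` {0<..<length \<alpha>} = set_of_comp \<alpha>"
    unfolding set_of_comp_eq using left by (intro image_cong) (auto simp: length_\<alpha>)
  moreover have "psum (odot \<alpha> \<beta>) ` (+) (length \<alpha>') ` {0<..<length \<beta>} = (+) (sum_list \<alpha>) ` set_of_comp \<beta>"
    unfolding set_of_comp_eq image_image by (intro image_cong) (auto simp: right)
  ultimately show ?thesis
    unfolding set_of_comp_eq[of "odot \<alpha> \<beta>"] by (simp only: image_Un)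
qed

lemma comp_append:
  assumes "X \<subseteq> {1..<m}" "Y \<subseteq> {1..<n}" "0 < m" "0 < n"
  shows "comp m X @ comp n Y = comp (m + n) (X \<union> {m} \<union> (+) m ` Y)"
proof -
  have "is_comp (comp m X @ comp n Y)"
    using assms is_comp_comp by (auto simp: is_comp_def)
  moreover have "comp m X \<noteq> []" "comp n Y \<noteq> []"
    using sum_list_comp[OF assms(1)] sum_list_comp[OF assms(2)] assms(3,4) by auto
  then have "set_of_comp (comp m X @ comp n Y) = X \<union> {m} \<union> (+) m ` Y"
    by (subst set_of_comp_append) (simp_all add: sum_list_comp[OF assms(1)]
      set_of_comp_comp[OF assms(1)] set_of_comp_comp[OF assms(2)] del: One_nat_def)
  ultimately show ?thesis
    using comp_set_of_comp[of "comp m X @ comp n Y"]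
    by (simp only: sum_list_append sum_list_comp[OF assms(1)] sum_list_comp[OF assms(2)])
qed

text \<open>Only the split after \<open>length \<alpha>\<close> entries can match, so the product of
  two basis elements is their concatenation.\<close>

lemma sum_deconcatenations:
  "(\<Sum>i\<in>{0..length \<gamma>}. of_bool (\<alpha> = take i \<gamma>) * of_bool (\<beta> = drop i \<gamma>) :: 'a::comm_semiring_1)
    = of_bool (\<alpha> @ \<beta> = \<gamma>)"
proof -
  have "(\<Sum>i\<in>{0..length \<gamma>}. of_bool (\<alpha> = take i \<gamma>) * of_bool (\<beta> = drop i \<gamma>) :: 'a) =
      (\<Sum>i\<in>{0..length \<gamma>}. if i = length \<alpha> then of_bool (\<alpha> @ \<beta> = \<gamma>) else 0)"
  proof (intro sum.cong refl)
    fix i assume "i \<in> {0..length \<gamma>}"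
    then have "\<alpha> = take i \<gamma> \<and> \<beta> = drop i \<gamma> \<longleftrightarrow> i = length \<alpha> \<and> \<alpha> @ \<beta> = \<gamma>" by auto
    then show "of_bool (\<alpha> = take i \<gamma>) * of_bool (\<beta> = drop i \<gamma>) =
        (if i = length \<alpha> then of_bool (\<alpha> @ \<beta> = \<gamma>) else 0 :: 'a)"
      by (auto simp flip: of_bool_conj)
  qed
  also have "\<dots> = of_bool (\<alpha> @ \<beta> = \<gamma>)" by auto
  finally show ?thesis .
qed

lemma nsym_mult_Bcoef:
  assumes I: "I \<subseteq> {1..<m}" and J: "J \<subseteq> {1..<n}" and pos: "0 < m" "0 < n"
  shows "nsym_mult (Bcoef q t m I) (Bcoef q t n J) \<gamma> = Bcoef q t (m + n) (I \<union> (+) m ` J) \<gamma>"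
proof -
  let ?J = "(+) m ` J"
  have inj: "inj_on ((+) m) J" by simp
  have IJ: "I \<union> ?J \<subseteq> {1..<m + n}" using I J by force
  have disj: "I \<inter> ?J = {}" using I J by force
  have fin: "finite I" "finite J" using I J finite_subset by blast+
  define f where "f U = q ^ card U * t ^ card (I - U)" for U :: "nat set"
  define g where "g V = q ^ card V * t ^ card (J - V)" for V :: "nat set"
  have "nsym_mult (Bcoef q t m I) (Bcoef q t n J) \<gamma> =
    (\<Sum>i\<in>{0..length \<gamma>}. \<Sum>U\<in>Pow I. \<Sum>V\<in>Pow J. f U * g V *
       (of_bool (comp m ({1..<m} - U) = take i \<gamma>) * of_bool (comp n ({1..<n} - V) = drop i \<gamma>)))"
    unfolding nsym_mult_def Bcoef_Pow[OF I] Bcoef_Pow[OF J] sum_product f_def g_def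
    by (simp only: mult_ac)
  also have "\<dots> = (\<Sum>U\<in>Pow I. \<Sum>i\<in>{0..length \<gamma>}. \<Sum>V\<in>Pow J. f U * g V *
       (of_bool (comp m ({1..<m} - U) = take i \<gamma>) * of_bool (comp n ({1..<n} - V) = drop i \<gamma>)))"
    by (rule sum.swap)
  also have "\<dots> = (\<Sum>U\<in>Pow I. \<Sum>V\<in>Pow J. \<Sum>i\<in>{0..length \<gamma>}. f U * g V *
       (of_bool (comp m ({1..<m} - U) = take i \<gamma>) * of_bool (comp n ({1..<n} - V) = drop i \<gamma>)))"
    by (intro sum.cong refl sum.swap)
  also have "\<dots> = (\<Sum>U\<in>Pow I. \<Sum>V\<in>Pow J. f U * g V *
       of_bool (comp m ({1..<m} - U) @ comp n ({1..<n} - V) = \<gamma>))"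
    by (simp only: sum_distrib_left[symmetric] sum_deconcatenations)
  also have "\<dots> = (\<Sum>U\<in>Pow I. \<Sum>V\<in>Pow J.
      of_bool (comp (m + n) ({1..<m + n} - (U \<union> (+) m ` V)) = \<gamma>) *
      (q ^ card (U \<union> (+) m ` V) * t ^ card (I \<union> ?J - (U \<union> (+) m ` V))))"
  proof (intro sum.cong refl)
    fix U V assume UV: "U \<in> Pow I" "V \<in> Pow J"
    then have finUV: "finite U" "finite V" using fin finite_subset by blast+
    have "comp m ({1..<m} - U) @ comp n ({1..<n} - V) =
        comp (m + n) (({1..<m} - U) \<union> {m} \<union> (+) m ` ({1..<n} - V))"
      using pos by (intro comp_append) auto
    also have "({1..<m} - U) \<union> {m} \<union> (+) m ` ({1..<n} - V) = {1..<m + n} - (U \<union> (+) m ` V)"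
    proof -
      have "{1..<m + n} = {1..<m} \<union> {m} \<union> (+) m ` {1..<n}"
      proof (intro equalityI subsetI)
        fix i assume i: "i \<in> {1..<m + n}"
        show "i \<in> {1..<m} \<union> {m} \<union> (+) m ` {1..<n}"
        proof (cases "m < i")
          case True
          then have "i = m + (i - m)" "i - m \<in> {1..<n}" using i by auto
          then show ?thesis by blast
        qed (use i in auto)
      qed (use pos in auto)
      moreover have "U \<inter> ({m} \<union> (+) m ` {1..<n}) = {}" "(+) m ` V \<inter> ({1..<m} \<union> {m}) = {}"
        using UV I J by force+
      moreover have "(+) m ` ({1..<n} - V) = (+) m ` {1..<n} - (+) m ` V"
        by (simp only: image_set_diff inj_on_add)
      ultimately show ?thesis by blast
    qed
    finally have c: "comp m ({1..<m} - U) @ comp n ({1..<n} - V) = comp (m + n) ({1..<m + n} - (U \<union> (+) m ` V))" .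
    have "U \<inter> (+) m ` V = {}" using UV disj by blast
    then have d: "card (U \<union> (+) m ` V) = card U + card V"
      using finUV by (simp add: card_Un_disjoint card_image)
    have "I \<union> ?J - (U \<union> (+) m ` V) = (I - U) \<union> (?J - (+) m ` V)"
      using UV disj by blast
    also have "?J - (+) m ` V = (+) m ` (J - V)"
      by (simp only: image_set_diff inj_on_add)
    finally have "card (I \<union> ?J - (U \<union> (+) m ` V)) = card ((I - U) \<union> (+) m ` (J - V))" by simp
    also have "\<dots> = card (I - U) + card ((+) m ` (J - V))"
      using disj fin by (intro card_Un_disjoint) auto
    finally have e: "card (I \<union> ?J - (U \<union> (+) m ` V)) = card (I - U) + card (J - V)"
      by (simp add: card_image)
    show "f U * g V * of_bool (comp m ({1..<m} - U) @ comp n ({1..<n} - V) = \<gamma>) =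
      of_bool (comp (m + n) ({1..<m + n} - (U \<union> (+) m ` V)) = \<gamma>) *
      (q ^ card (U \<union> (+) m ` V) * t ^ card (I \<union> ?J - (U \<union> (+) m ` V)))"
      unfolding c d e f_def g_def power_add by (simp only: mult_ac)
  qed
  also have "\<dots> = (\<Sum>U\<in>Pow I. \<Sum>W\<in>Pow ?J.
      of_bool (comp (m + n) ({1..<m + n} - (U \<union> W)) = \<gamma>) *
      (q ^ card (U \<union> W) * t ^ card (I \<union> ?J - (U \<union> W))))"
    unfolding image_Pow_surj[OF refl, of "(+) m" J, symmetric]
    by (subst sum.reindex[OF inj_on_image_Pow[OF inj]]) simp
  also have "\<dots> = Bcoef q t (m + n) (I \<union> ?J) \<gamma>"
    unfolding Bcoef_Pow[OF IJ] sum_Pow_Un[OF disj] ..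
  finally show ?thesis .
qed

text \<open>The unit of the product. Empty compositions are treated apart because the junction is an
  interior position only when both degrees are positive.\<close>

lemma Bcomp_Nil: "Bcomp q t [] = (\<lambda>\<gamma>. of_bool (\<gamma> = []))"
  by (auto simp: Bcomp_def Bcoef_def set_of_comp_def comp_def fun_eq_iff)

lemma nsym_mult_one_left: "nsym_mult (\<lambda>\<gamma>. of_bool (\<gamma> = [])) g = g"
proof
  fix \<gamma> :: "nat list"
  have "nsym_mult (\<lambda>\<gamma>. of_bool (\<gamma> = [])) g \<gamma> = (\<Sum>i\<in>{0..length \<gamma>}. if i = 0 then g \<gamma> else 0)"
    unfolding nsym_mult_def by (intro sum.cong) auto
  then show "nsym_mult (\<lambda>\<gamma>. of_bool (\<gamma> = [])) g \<gamma> = g \<gamma>" by simp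
qed

lemma nsym_mult_one_right: "nsym_mult f (\<lambda>\<gamma>. of_bool (\<gamma> = [])) = f"
proof
  fix \<gamma> :: "nat list"
  have "nsym_mult f (\<lambda>\<gamma>. of_bool (\<gamma> = [])) \<gamma> = (\<Sum>i\<in>{0..length \<gamma>}. if i = length \<gamma> then f \<gamma> else 0)"
    unfolding nsym_mult_def by (intro sum.cong) auto
  then show "nsym_mult f (\<lambda>\<gamma>. of_bool (\<gamma> = [])) \<gamma> = f \<gamma>" by simp
qed

lemma nsym_mult_Bcomp:
  assumes "is_comp \<alpha>" "is_comp \<beta>"
  shows "nsym_mult (Bcomp q t \<alpha>) (Bcomp q t \<beta>) = Bcomp q t (odot \<alpha> \<beta>)"
proof (cases "\<alpha> = [] \<or> \<beta> = []")
  case True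
  then show ?thesis by (auto simp: Bcomp_Nil nsym_mult_one_left nsym_mult_one_right)
next
  case False
  then have "0 < sum_list \<alpha>" "0 < sum_list \<beta>"
    using psum_strict_mono[OF assms(1), of 0 "length \<alpha>"]
      psum_strict_mono[OF assms(2), of 0 "length \<beta>"] unfolding psum_0 psum_length by blast+
  then show ?thesis
    using False nsym_mult_Bcoef[OF set_of_comp_subset set_of_comp_subset, OF assms]
    unfolding Bcomp_def by (auto simp: fun_eq_iff sum_list_odot set_of_comp_odot)
qed

lemma tv_nonzero: "tv \<noteq> 0"
  unfolding tv_def by (simp add: Zero_fract_def eq_fract)

theorem theorem4p7:
  shows "(\<forall>k K. K \<subseteq> {1..<k} \<longrightarrow>
            (\<forall>\<beta> \<gamma>. nsym_coprod (Bcoef qv tv k K) (\<beta>, \<gamma>) =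
               (\<Sum>m\<in>{0..k}. \<Sum>I\<in>Pow {1..<m}. \<Sum>J\<in>Pow {1..<k - m}.
                  Ccoef qv tv m (k - m) K I J * Bcoef qv tv m I \<beta> * Bcoef qv tv (k - m) J \<gamma>)))
       \<and> (\<forall>\<alpha> \<beta>. is_comp \<alpha> \<longrightarrow> is_comp \<beta> \<longrightarrow>
            nsym_mult (Bcomp qv tv \<alpha>) (Bcomp qv tv \<beta>) = Bcomp qv tv (odot \<alpha> \<beta>))"
  using nsym_coprod_Bcoef_eq_sum_Ccoef[OF _ tv_nonzero] nsym_mult_Bcomp by blast

end
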